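(* Let $X$ be a countably generated right Hilbert C*-module over a $\sigma$-unital C*-algebra $A$. Then $X$ has an unconditionally convergent right basis indexed by $\mathbb N=\{1,2,\dots\}$.
   Context: An unconditionally convergent right basis of a right Hilbert $A$-module $X$ is a family $\{u_i\}_{i\in\Lambda}\subset X$ such that for any $x\in X$ and any $\varepsilon>0$ there is a finite subset $F(\varepsilon,x)\subset\Lambda$ such that for every finite subset $F'\supset F(\varepsilon,x)$ of $\Lambda$, $\|x-\sum_{i\in F'}u_i(u_i|x)_A\|<\varepsilon$. The inner product $(\cdot|\cdot)_A$ is linear in the second variable. *)

theory Defs
  imports Complex_Main "HOL-Library.Countable_Set"
begin

text \<open>
  Complex Banach spaces, obtained by adding a complex scalar multiplication to the class
  \<^class>\<open>banach\<close>. The law \<open>scaleR_scaleC\<close> makes the real scalar multiplication the restriction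
  of the complex one; it also yields \<open>1 *\<^sub>C x = x\<close>.
\<close>

class complex_banach = banach +
  fixes scaleC :: "complex \<Rightarrow> 'a \<Rightarrow> 'a"  (infixr "*\<^sub>C" 75)
  assumes scaleC_add_right: "c *\<^sub>C (x + y) = c *\<^sub>C x + c *\<^sub>C y"
    and scaleC_add_left: "(c + d) *\<^sub>C x = c *\<^sub>C x + d *\<^sub>C x"
    and scaleC_scaleC: "c *\<^sub>C (d *\<^sub>C x) = (c * d) *\<^sub>C x"
    and scaleR_scaleC: "r *\<^sub>R x = complex_of_real r *\<^sub>C x"
    and norm_scaleC: "norm (c *\<^sub>C x) = cmod c * norm x"

text \<open>C*-algebras, not necessarily unital.\<close>

class cstar_algebra = complex_banach + real_normed_algebra +
  fixes star :: "'a \<Rightarrow> 'a"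
  assumes mult_scaleC_left: "(c *\<^sub>C a) * b = c *\<^sub>C (a * b)"
    and mult_scaleC_right: "a * (c *\<^sub>C b) = c *\<^sub>C (a * b)"
    and star_star: "star (star a) = a"
    and star_add: "star (a + b) = star a + star b"
    and star_scaleC: "star (c *\<^sub>C a) = cnj c *\<^sub>C star a"
    and star_mult: "star (a * b) = star b * star a"
    and cstar_identity: "norm (star a * a) = (norm a)\<^sup>2"

definition cstar_positive :: "'a::cstar_algebra \<Rightarrow> bool" where
  "cstar_positive a \<longleftrightarrow> (\<exists>b. a = star b * b)"

text \<open>
  A C*-algebra is \<open>\<sigma>\<close>-unital if it has a countable approximate unit, that is, an increasing sequence
  of positive contractions acting as a unit in the limit.
\<close>

definition sigma_unital :: "'a::cstar_algebra itself \<Rightarrow> bool" where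
  "sigma_unital _ \<longleftrightarrow>
    (\<exists>e :: nat \<Rightarrow> 'a.
       (\<forall>n. cstar_positive (e n) \<and> norm (e n) \<le> 1 \<and> cstar_positive (e (Suc n) - e n)) \<and>
       (\<forall>a. (\<lambda>n. a * e n) \<longlonglongrightarrow> a \<and> (\<lambda>n. e n * a) \<longlonglongrightarrow> a))"

text \<open>
  The inner product is linear in the second variable. Its definiteness and the completeness of the
  module are contained in \<open>norm_eq\<close>, which identifies the norm of the Banach space \<open>'x\<close> with the
  norm induced by the inner product.
\<close>

locale right_hilbert_module =
  fixes act :: "'x::complex_banach \<Rightarrow> 'a::cstar_algebra \<Rightarrow> 'x"  (infixl "\<cdot>" 70)
    and ip :: "'x \<Rightarrow> 'x \<Rightarrow> 'a"
  assumes act_add_left: "(x + y) \<cdot> a = x \<cdot> a + y \<cdot> a"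
    and act_add_right: "x \<cdot> (a + b) = x \<cdot> a + x \<cdot> b"
    and act_mult: "x \<cdot> (a * b) = (x \<cdot> a) \<cdot> b"
    and act_scaleC_left: "(c *\<^sub>C x) \<cdot> a = c *\<^sub>C (x \<cdot> a)"
    and act_scaleC_right: "x \<cdot> (c *\<^sub>C a) = c *\<^sub>C (x \<cdot> a)"
    and ip_add_right: "ip x (y + z) = ip x y + ip x z"
    and ip_scaleC_right: "ip x (c *\<^sub>C y) = c *\<^sub>C ip x y"
    and ip_act_right: "ip x (y \<cdot> a) = ip x y * a"
    and star_ip: "star (ip x y) = ip y x"
    and ip_positive: "cstar_positive (ip x x)"
    and norm_eq: "norm x = sqrt (norm (ip x x))"
begin

definition closed_submodule :: "'x set \<Rightarrow> bool" where
  "closed_submodule M \<longleftrightarrow>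
     closed M \<and> 0 \<in> M \<and> (\<forall>x\<in>M. \<forall>y\<in>M. x + y \<in> M) \<and>
     (\<forall>c. \<forall>x\<in>M. c *\<^sub>C x \<in> M) \<and> (\<forall>x\<in>M. \<forall>a. x \<cdot> a \<in> M)"

definition countably_generated :: bool where
  "countably_generated \<longleftrightarrow> (\<exists>S. countable S \<and> closed_submodule hull S = UNIV)"

definition unconditionally_convergent_right_basis :: "'i set \<Rightarrow> ('i \<Rightarrow> 'x) \<Rightarrow> bool" where
  "unconditionally_convergent_right_basis \<Lambda> u \<longleftrightarrow>
     (\<forall>x. \<forall>\<epsilon>>0. \<exists>F. finite F \<and> F \<subseteq> \<Lambda> \<and>
        (\<forall>F'. finite F' \<and> F \<subseteq> F' \<and> F' \<subseteq> \<Lambda> \<longrightarrow>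
           norm (x - (\<Sum>i\<in>F'. u i \<cdot> ip (u i) x)) < \<epsilon>))"

end

end

theory Submission
  imports Defs "HOL-Analysis.Elementary_Normed_Spaces" "HOL-Analysis.Operator_Norm"
begin

text \<open>
  Matching pursuit. Let \<open>v\<^sub>0, v\<^sub>1, \<dots>\<close> run through suitably scaled generators of norm at most \<open>1\<close>,
  each of them occurring infinitely often. Put \<open>T\<^sub>0 = 1\<close>, \<open>u\<^sub>n\<^sub>+\<^sub>1 = T\<^sub>n v\<^sub>n\<close> and
  \<open>T\<^sub>n\<^sub>+\<^sub>1 = T\<^sub>n - u\<^sub>n\<^sub>+\<^sub>1 (u\<^sub>n\<^sub>+\<^sub>1|\<cdot>)\<close>. The Cauchy--Schwarz inequality for the form \<open>(x|T\<^sub>n y)\<close> gives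
  \<open>0 \<le> T\<^sub>n \<le> 1\<close>. For a generator \<open>w\<close>, the elements \<open>a\<^sub>n = (w|T\<^sub>n w)\<close> decrease, and by exactly
  \<open>a\<^sub>n\<^sup>2\<close> whenever \<open>v\<^sub>n = w\<close>; so the sum of these squares is at most \<open>a\<^sub>0\<close>, and convexity of the square
  forces \<open>a\<^sub>n \<rightarrow> 0\<close>. Since \<open>\<parallel>T x\<parallel>\<^sup>2 \<le> \<parallel>(x|T x)\<parallel>\<close> whenever \<open>0 \<le> T \<le> 1\<close>, it follows that \<open>T\<^sub>n x \<rightarrow> 0\<close> on a
  closed submodule containing the generators. The same inequality, applied to \<open>1 - \<Sum>\<^bsub>i\<in>F\<^esub> u\<^sub>i (u\<^sub>i|\<cdot>)\<close>,
  which decreases in \<open>F\<close>, makes the convergence unconditional.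

  The order on \<open>'a\<close> is that of its unitization, where positivity of \<open>b\<^sup>* b\<close> (Kaplansky's theorem) is
  proved with square roots given by the power series of \<open>sqrt (1 - x)\<close>.
\<close>

subsection \<open>C*-algebras\<close>

lemma scaleC_one [simp]: "1 *\<^sub>C x = x" for x :: "'a::complex_banach"
  using scaleR_scaleC[of 1 x] by simp

lemma scaleC_minus1: "(- 1) *\<^sub>C x = - x" for x :: "'a::complex_banach"
  using scaleR_scaleC[of "- 1" x] by simp

lemma scaleC_zero_right [simp]: "c *\<^sub>C 0 = (0::'a::complex_banach)"
  using scaleC_add_right[of c "0::'a" 0] by simp

lemma scaleC_zero_left [simp]: "0 *\<^sub>C x = (0::'a::complex_banach)"
  using scaleR_scaleC[of 0 x] by simp

lemma scaleC_scaleR: "c *\<^sub>C (r *\<^sub>R x) = r *\<^sub>R (c *\<^sub>C x)" for x :: "'a::complex_banach"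
  by (simp add: scaleR_scaleC scaleC_scaleC mult.commute)

lemma scaleC_minus_right: "c *\<^sub>C (- x) = - (c *\<^sub>C x)" for x :: "'a::complex_banach"
  by (metis add.right_inverse add_eq_0_iff2 minus_add_cancel scaleC_add_right scaleC_zero_right)

lemma scaleC_minus_left: "(- c) *\<^sub>C x = - (c *\<^sub>C x)" for x :: "'a::complex_banach"
  by (metis add.right_inverse add_eq_0_iff scaleC_add_left scaleC_zero_left)

lemma scaleC_diff_right: "c *\<^sub>C (x - y) = c *\<^sub>C x - c *\<^sub>C y" for x :: "'a::complex_banach"
  using scaleC_add_right[of c x "- y"] by (simp add: scaleC_minus_right)

lemma star_0 [simp]: "star (0::'a::cstar_algebra) = 0"
  using star_add[of "0::'a" 0] by simp

lemma star_scaleR: "star (r *\<^sub>R a) = r *\<^sub>R star a" for a :: "'a::cstar_algebra"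
  by (simp add: scaleR_scaleC star_scaleC)

lemma star_minus: "star (- a) = - star a" for a :: "'a::cstar_algebra"
  using star_scaleR[of "- 1" a] by simp

lemma star_diff: "star (a - b) = star a - star b" for a :: "'a::cstar_algebra"
  using star_add[of a "- b"] by (simp add: star_minus)

text \<open>The C*-identity bounds the square of \<open>norm b\<close> by
  \<open>norm (star b) * norm b\<close>; cancelling, and repeating for \<open>star b\<close>, gives
  both inequalities.\<close>

lemma norm_star [simp]: "norm (star a) = norm a" for a :: "'a::cstar_algebra"
proof -
  have le: "norm b \<le> norm (star b)" for b :: 'a
  proof (cases "b = 0")
    case False
    have "norm b * norm b \<le> norm (star b) * norm b"
      using cstar_identity[of b] norm_mult_ineq[of "star b" b] by (simp add: power2_eq_square)
    with False show ?thesis by simp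
  qed simp
  show ?thesis using le[of a] le[of "star a"] by (simp add: star_star)
qed

lemma bounded_linear_star: "bounded_linear (star :: 'a::cstar_algebra \<Rightarrow> 'a)"
  by (rule bounded_linear_intro[of _ 1]) (simp_all add: star_add star_scaleR)

lemma star_sum: "star (sum f F) = (\<Sum>i\<in>F. star (f i))" for f :: "'i \<Rightarrow> 'a::cstar_algebra"
  by (induction F rule: infinite_finite_induct) (simp_all add: star_add)

lemma star_mult_self_eq_0: "star a * a = 0 \<longleftrightarrow> a = 0" for a :: "'a::cstar_algebra"
  using cstar_identity[of a] by auto

lemma norm_mult_self: "star a = a \<Longrightarrow> norm (a * a) = (norm a)\<^sup>2" for a :: "'a::cstar_algebra"
  using cstar_identity[of a] by simp

text \<open>Square roots and comparison with scalars require a unit. The algebra of the theorem may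
  lack one, so these arguments are made here and transferred through the unitization.\<close>

class unital_cstar_algebra = cstar_algebra + real_normed_algebra_1

lemma star_1 [simp]: "star (1::'a::unital_cstar_algebra) = 1"
  by (metis mult_1_left mult_1_right star_mult star_star)

lemma star_of_real [simp]: "star (of_real r :: 'a::unital_cstar_algebra) = of_real r"
  by (simp add: of_real_def star_scaleR)

lemma star_power: "star (a ^ n) = star a ^ n" for a :: "'a::unital_cstar_algebra"
  by (induction n) (simp_all add: star_mult power_commutes)

subsection \<open>Square roots\<close>

text \<open>The coefficients of the power series \<open>G\<close> with \<open>1 - G x = sqrt (1 - x)\<close>, read off from
  \<open>2 * G x = x + (G x)\<^sup>2\<close>.\<close>

fun sqrt_coeff :: "nat \<Rightarrow> real" where
  "sqrt_coeff 0 = 0"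
| "sqrt_coeff (Suc 0) = 1 / 2"
| "sqrt_coeff (Suc (Suc n)) = (\<Sum>i\<le>n. sqrt_coeff (Suc i) * sqrt_coeff (Suc (n - i))) / 2"

lemma sqrt_coeff_nonneg: "0 \<le> sqrt_coeff n"
  by (induction n rule: sqrt_coeff.induct) (auto intro!: sum_nonneg divide_nonneg_nonneg mult_nonneg_nonneg)

lemma sqrt_coeff_convolution:
  "2 * sqrt_coeff n = (if n = 1 then 1 else 0) + (\<Sum>i\<le>n. sqrt_coeff i * sqrt_coeff (n - i))"
proof (cases n rule: sqrt_coeff.cases)
  case (3 m)
  have "(\<Sum>i\<le>Suc (Suc m). sqrt_coeff i * sqrt_coeff (Suc (Suc m) - i))
      = (\<Sum>i\<le>m. sqrt_coeff (Suc i) * sqrt_coeff (Suc (m - i)))"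
    by (subst sum.atMost_Suc_shift) (simp add: Suc_diff_le)
  then show ?thesis using 3 by simp
qed auto

text \<open>If \<open>s\<close> is the sum of the first \<open>n\<close> coefficients, the next
  partial sum is at most \<open>(1 + s * s) / 2\<close>, so the bound \<open>1\<close>
  propagates.\<close>

lemma sqrt_coeff_partial_sum_le: "(\<Sum>k<n. sqrt_coeff k) \<le> 1"
proof (induction n)
  case (Suc n)
  have "2 * (\<Sum>k<Suc n. sqrt_coeff k)
      \<le> 1 + (\<Sum>k<Suc n. \<Sum>i\<le>k. sqrt_coeff i * sqrt_coeff (k - i))"
    unfolding sum_distrib_left sqrt_coeff_convolution sum.distrib
    by (simp add: sum.delta' if_distrib cong: if_cong)
  also have "(\<Sum>k<Suc n. \<Sum>i\<le>k. sqrt_coeff i * sqrt_coeff (k - i))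
      = (\<Sum>(i, j)\<in>{(i, j). i + j < Suc n}. sqrt_coeff i * sqrt_coeff j)"
    by (simp add: sum.triangle_reindex)
  \<comment> \<open>A pair with \<open>i + j \<le> n\<close> outside the square has one index
    \<open>n\<close> and the other \<open>0\<close>, so its product vanishes.\<close>
  also have "\<dots> = (\<Sum>(i, j)\<in>{(i, j). i + j < Suc n} \<inter> {..<n} \<times> {..<n}. sqrt_coeff i * sqrt_coeff j)"
  proof (rule sum.mono_neutral_right)
    show "finite {(i, j). i + j < Suc n}"
      by (rule finite_subset[of _ "{..n} \<times> {..n}"]) auto
    show "\<forall>x\<in>{(i, j). i + j < Suc n} - {(i, j). i + j < Suc n} \<inter> {..<n} \<times> {..<n}.
      (case x of (i, j) \<Rightarrow> sqrt_coeff i * sqrt_coeff j) = 0"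
    proof clarify
      fix i j assume "i + j < Suc n" "(i, j) \<notin> {(i, j). i + j < Suc n} \<inter> {..<n} \<times> {..<n}"
      then have "i = 0 \<or> j = 0" by auto
      then show "sqrt_coeff i * sqrt_coeff j = 0" by auto
    qed
  qed auto
  also have "\<dots> \<le> (\<Sum>(i, j)\<in>{..<n} \<times> {..<n}. sqrt_coeff i * sqrt_coeff j)"
    by (rule sum_mono2) (auto simp: sqrt_coeff_nonneg)
  also have "\<dots> = (\<Sum>k<n. sqrt_coeff k)\<^sup>2"
    by (simp add: power2_eq_square sum_product sum.cartesian_product)
  also have "\<dots> \<le> 1"
    using Suc by (simp add: power_le_one sum_nonneg sqrt_coeff_nonneg)
  finally show ?case by simp
qed simp

text \<open>The coefficients have sum at most \<open>1\<close>, so the series \<open>g\<close> for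
  \<open>1 - sqrt (1 - x)\<close> converges absolutely with \<open>norm g \<le> 1\<close>, and
  \<open>h = 1 - g\<close>. Whatever commutes with \<open>x\<close> commutes with every term of the
  series.\<close>

lemma sqrt_one_minus:
  fixes x :: "'a::unital_cstar_algebra"
  assumes x: "norm x \<le> 1" and sa: "star x = x"
  obtains h where "star h = h" "h * h = 1 - x" "norm (1 - h) \<le> 1"
    "\<And>y. y * x = x * y \<Longrightarrow> y * h = h * y"
proof -
  have bound: "norm (sqrt_coeff k *\<^sub>R x ^ k) \<le> sqrt_coeff k" for k
  proof -
    have "norm (x ^ k) \<le> 1"
      using norm_power_ineq[of x k] power_le_one[of "norm x" k] x by simp
    then show ?thesis
      using mult_left_mono[of "norm (x ^ k)" 1 "sqrt_coeff k"] by (simp add: sqrt_coeff_nonneg)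
  qed
  have sc: "summable sqrt_coeff"
    by (rule summableI_nonneg_bounded[of _ 1]) (auto simp: sqrt_coeff_nonneg sqrt_coeff_partial_sum_le)
  have "summable (\<lambda>k. norm (sqrt_coeff k *\<^sub>R x ^ k))"
    by (rule summable_comparison_test'[OF sc, of 0]) (unfold real_norm_def abs_norm_cancel, rule bound)
  note sn = this
  note s = summable_norm_cancel[OF sn]
  define g where "g = (\<Sum>k. sqrt_coeff k *\<^sub>R x ^ k)"
  have g: "(\<lambda>k. sqrt_coeff k *\<^sub>R x ^ k) sums g" using s by (simp add: g_def summable_sums)
  have "norm g \<le> (\<Sum>k. norm (sqrt_coeff k *\<^sub>R x ^ k))" unfolding g_def by (rule summable_norm[OF sn])
  also have "\<dots> \<le> (\<Sum>k. sqrt_coeff k)" by (rule suminf_le[OF _ sn sc]) (rule bound)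
  also have "\<dots> \<le> 1" by (rule suminf_le_const[OF sc]) (rule sqrt_coeff_partial_sum_le)
  finally have ng: "norm g \<le> 1" .
  have "(\<lambda>k. \<Sum>i\<le>k. (sqrt_coeff i *\<^sub>R x ^ i) * (sqrt_coeff (k - i) *\<^sub>R x ^ (k - i))) sums (g * g)"
    using Cauchy_product_sums[OF sn sn] by (simp add: g_def)
  moreover have "(\<Sum>i\<le>k. (sqrt_coeff i *\<^sub>R x ^ i) * (sqrt_coeff (k - i) *\<^sub>R x ^ (k - i)))
      = (2 * sqrt_coeff k) *\<^sub>R x ^ k - (if k = 1 then x else 0)" for k
  proof -
    have "(\<Sum>i\<le>k. (sqrt_coeff i *\<^sub>R x ^ i) * (sqrt_coeff (k - i) *\<^sub>R x ^ (k - i)))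
      = (\<Sum>i\<le>k. (sqrt_coeff i * sqrt_coeff (k - i)) *\<^sub>R x ^ k)"
      by (intro sum.cong) (simp_all add: power_add[symmetric])
    also have "\<dots> = (2 * sqrt_coeff k - (if k = 1 then 1 else 0)) *\<^sub>R x ^ k"
      by (simp add: sqrt_coeff_convolution scaleR_sum_left)
    finally show ?thesis by (auto simp: algebra_simps)
  qed
  moreover have "(\<lambda>k. (2 * sqrt_coeff k) *\<^sub>R x ^ k - (if k = 1 then x else 0)) sums (2 *\<^sub>R g - x)"
    using sums_diff[OF sums_scaleR_right[OF g, of 2] sums_single[of 1 "\<lambda>_. x"]] by simp
  ultimately have gg: "g * g = 2 *\<^sub>R g - x"
    by (simp add: sums_unique2)
  show ?thesis
  proof
    have "(\<lambda>k. star (sqrt_coeff k *\<^sub>R x ^ k)) sums star g"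
      by (rule bounded_linear.sums[OF bounded_linear_star g])
    then have "star g = g"
      using g by (simp add: star_scaleR star_power sa sums_unique2)
    then show "star (1 - g) = 1 - g" by (simp add: star_diff)
    show "(1 - g) * (1 - g) = 1 - x" using gg by (simp add: algebra_simps scaleR_2)
    show "norm (1 - (1 - g)) \<le> 1" using ng by simp
    show "y * (1 - g) = (1 - g) * y" if "y * x = x * y" for y
    proof -
      have yk: "y * x ^ k = x ^ k * y" for k
        using power_commuting_commutes[of x y k] that by simp
      have "(\<lambda>k. y * (sqrt_coeff k *\<^sub>R x ^ k)) sums (y * g)" "(\<lambda>k. (sqrt_coeff k *\<^sub>R x ^ k) * y) sums (g * y)"
        by (rule sums_mult[OF g], rule sums_mult2[OF g])
      then have "y * g = g * y" by (simp add: yk sums_unique2)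
      then show ?thesis by (simp add: algebra_simps)
    qed
  qed
qed

subsection \<open>Positive elements of a unital C*-algebra\<close>

text \<open>Commutation removes the cross terms in \<open>star u * u\<close> for
  \<open>u = h + \<i> *\<^sub>C k\<close>, and \<open>h\<close> is the real part of
  \<open>u\<close>, hence no larger in norm.\<close>

lemma norm_le_norm_sum_squares:
  fixes h k :: "'a::unital_cstar_algebra"
  assumes h: "star h = h" and k: "star k = k" and hk: "h * k = k * h"
  shows "(norm h)\<^sup>2 \<le> norm (h * h + k * k)"
proof -
  define u where "u = h + \<i> *\<^sub>C k"
  have su: "star u = h - \<i> *\<^sub>C k"
    by (simp add: u_def star_add star_scaleC h k scaleC_minus_left)
  have "star u * u = h * h + k * k"
    unfolding su unfolding u_def
    by (simp add: algebra_simps mult_scaleC_left mult_scaleC_right scaleC_scaleC hk scaleC_minus1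
        scaleC_diff_right)
  then have nu: "(norm u)\<^sup>2 = norm (h * h + k * k)"
    using cstar_identity[of u] by simp
  have "u + star u = h + h"
    unfolding su unfolding u_def
    by simp
  then have "2 * norm h = norm (u + star u)"
    by (metis norm_scaleR scaleR_2 abs_numeral)
  also have "\<dots> \<le> 2 * norm u" using norm_triangle_ineq[of u "star u"] by simp
  finally show ?thesis using nu power_mono[of "norm h" "norm u" 2] by simp
qed

text \<open>Positivity through a self-adjoint root. That every \<open>star b * b\<close> has this
  form is Kaplansky's theorem, \<open>sa_square_star_mult_self\<close>.\<close>

definition sa_square :: "'a::unital_cstar_algebra \<Rightarrow> bool" where
  "sa_square a \<longleftrightarrow> (\<exists>h. star h = h \<and> a = h * h)"

text \<open>For \<open>s > 0\<close>, rescaling writes \<open>a\<close> as \<open>s\<close> times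
  \<open>1 - x\<close> with \<open>norm x \<le> 1\<close>. The root is again near a scalar, so it
  has a root itself; the commutation clause lets roots be combined.\<close>

lemma sqrt_near_scalar:
  fixes a :: "'a::unital_cstar_algebra"
  assumes sa: "star a = a" and s: "norm (of_real s - a) \<le> s"
  obtains h where "star h = h" "a = h * h" "norm (of_real (sqrt s) - h) \<le> sqrt s"
    "\<And>y. y * a = a * y \<Longrightarrow> y * h = h * y"
proof (cases "s = 0")
  case True
  with s have "a = 0" by simp
  then show ?thesis using that[of 0] True by simp
next
  case False
  with s have s0: "s > 0" using norm_ge_zero order_trans by (metis less_eq_real_def)
  define x where "x = 1 - (1 / s) *\<^sub>R a"
  have x: "x = (1 / s) *\<^sub>R (of_real s - a)"
    using s0 by (simp add: x_def scaleR_diff_right of_real_def)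
  have "norm x \<le> 1" "star x = x"
    using s s0 by (simp_all add: x x_def[symmetric] divide_le_eq) (simp add: x_def star_diff star_scaleR sa)
  then obtain h where h: "star h = h" "h * h = 1 - x" "norm (1 - h) \<le> 1"
    and comm: "\<And>y. y * x = x * y \<Longrightarrow> y * h = h * y"
    using sqrt_one_minus by metis
  show ?thesis
  proof
    show "star (sqrt s *\<^sub>R h) = sqrt s *\<^sub>R h" by (simp add: star_scaleR h)
    show "a = (sqrt s *\<^sub>R h) * (sqrt s *\<^sub>R h)"
      using s0 by (simp add: h x_def)
    have "of_real (sqrt s) - sqrt s *\<^sub>R h = sqrt s *\<^sub>R (1 - h)"
      by (simp add: of_real_def scaleR_diff_right)
    then show "norm (of_real (sqrt s) - sqrt s *\<^sub>R h) \<le> sqrt s"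
      using h(3) s0 by (simp add: mult_left_le)
    show "y * (sqrt s *\<^sub>R h) = (sqrt s *\<^sub>R h) * y" if "y * a = a * y" for y
      using comm[of y] that by (simp add: x_def algebra_simps)
  qed
qed

lemma sa_square_self_adjoint: "sa_square a \<Longrightarrow> star a = a"
  by (auto simp: sa_square_def star_mult)

lemma sa_squareI:
  "star a = a \<Longrightarrow> norm (of_real s - a) \<le> s \<Longrightarrow> sa_square a"
  unfolding sa_square_def using sqrt_near_scalar by metis

text \<open>A root \<open>k\<close> of \<open>s - a\<close> commutes with the root \<open>h\<close>
  of \<open>a\<close>, and \<open>k * k + h * h\<close> is the scalar \<open>s\<close>, which
  dominates \<open>k * k\<close> in norm. With \<open>sa_squareI\<close> this turns positivity into
  a norm condition.\<close>

lemma sa_square_near_scalar: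
  assumes a: "sa_square a" and s: "norm a \<le> s"
  shows "norm (of_real s - a) \<le> s"
proof -
  obtain h where h: "star h = h" "a = h * h" using a by (auto simp: sa_square_def)
  have "norm (of_real s - (of_real s - a)) \<le> s" "star (of_real s - a) = of_real s - a"
    using s by (simp_all add: star_diff sa_square_self_adjoint[OF a])
  then obtain k where k: "star k = k" "of_real s - a = k * k"
    and comm: "\<And>y. y * (of_real s - a) = (of_real s - a) * y \<Longrightarrow> y * k = k * y"
    using sqrt_near_scalar by metis
  have "h * k = k * h"
    by (rule comm) (simp add: algebra_simps h of_real_def)
  then have "(norm k)\<^sup>2 \<le> norm (k * k + h * h)"
    using norm_le_norm_sum_squares[OF k(1) h(1)] by simp
  also have "k * k + h * h = of_real s" by (simp add: k(2)[symmetric] h(2)[symmetric])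
  also have "norm (of_real s :: 'a) = s" using order_trans[OF norm_ge_zero s] by simp
  finally show ?thesis by (simp add: k norm_mult_self)
qed

text \<open>Distances to scalars add by the triangle inequality; the roots themselves need not
  commute and would not combine.\<close>

lemma sa_square_add: "sa_square a \<Longrightarrow> sa_square b \<Longrightarrow> sa_square (a + b)"
proof (rule sa_squareI[where s = "norm a + norm b"])
  assume a: "sa_square a" and b: "sa_square b"
  show "star (a + b) = a + b" using a b by (simp add: star_add sa_square_self_adjoint)
  have "norm ((of_real (norm a) - a) + (of_real (norm b) - b)) \<le> norm a + norm b"
    by (intro norm_triangle_mono sa_square_near_scalar a b order_refl)
  then show "norm (of_real (norm a + norm b) - (a + b)) \<le> norm a + norm b"
    by (simp add: algebra_simps)
qed

lemma sa_square_norm_minus: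
  "star a = a \<Longrightarrow> norm a \<le> s \<Longrightarrow> sa_square (of_real s - a)"
  by (rule sa_squareI[where s = s]) (simp_all add: star_diff)

text \<open>A root \<open>h\<close> of \<open>a\<close> can be chosen to commute with the root
  \<open>k\<close> of \<open>b = - a\<close>, so the square of \<open>norm h\<close> is at most
  \<open>norm (a + b) = 0\<close>.\<close>

lemma sa_square_plus_sa_square_eq_0:
  assumes a: "sa_square a" and b: "sa_square b" and ab: "a + b = 0"
  shows "a = 0"
proof -
  obtain k where k: "star k = k" "b = k * k" using b by (auto simp: sa_square_def)
  obtain h where h: "star h = h" "a = h * h"
    and comm: "\<And>y. y * a = a * y \<Longrightarrow> y * h = h * y"
    using sqrt_near_scalar[OF sa_square_self_adjoint[OF a] sa_square_near_scalar[OF a order_refl]]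
    by metis
  have "a = - (k * k)" using ab k by (simp add: eq_neg_iff_add_eq_0)
  then have "h * k = k * h" using comm[of k] by (simp add: mult.assoc)
  from norm_le_norm_sum_squares[OF h(1) k(1) this] have "norm h = 0"
    using ab h k by simp
  then show ?thesis using h by simp
qed

text \<open>Both \<open>norm b - b\<close> and \<open>b - a\<close> are positive, so
  \<open>norm b - a\<close> has a root \<open>k\<close>. It commutes with a root \<open>h\<close> of
  \<open>a\<close>, and \<open>h * h + k * k\<close> is the scalar \<open>norm b\<close>.\<close>

lemma sa_square_norm_mono:
  assumes a: "sa_square a" and ba: "sa_square (b - a)"
  shows "norm a \<le> norm b"
proof -
  have "star b = star (b - a) + star a" by (simp add: star_diff)
  then have "star b = b"
    using sa_square_self_adjoint[OF a] sa_square_self_adjoint[OF ba] by simp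
  then have "sa_square (of_real (norm b) - b)" by (simp add: sa_square_norm_minus)
  from sa_square_add[OF this ba] have "sa_square (of_real (norm b) - a)" by simp
  then obtain k where k: "star k = k" "of_real (norm b) - a = k * k" by (auto simp: sa_square_def)
  obtain h where h: "star h = h" "a = h * h"
    and comm: "\<And>y. y * a = a * y \<Longrightarrow> y * h = h * y"
    using sqrt_near_scalar[OF sa_square_self_adjoint[OF a] sa_square_near_scalar[OF a order_refl]]
    by metis
  have ak: "a = of_real (norm b) - k * k" by (simp add: k(2)[symmetric])
  have "k * a = a * k" unfolding ak by (simp add: algebra_simps of_real_def)
  then have "h * k = k * h" using comm by simp
  from norm_le_norm_sum_squares[OF h(1) k(1) this] have "(norm h)\<^sup>2 \<le> norm b"
    unfolding h(2)[symmetric] k(2)[symmetric] by simp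
  then show ?thesis unfolding h(2) norm_mult_self[OF h(1)] .
qed

section \<open>Kaplansky's theorem\<close>

lemma norm_power_two_power:
  fixes y :: "'a::unital_cstar_algebra"
  assumes "star y = y"
  shows "norm (y ^ (2 ^ k)) = norm y ^ (2 ^ k)"
proof (induction k)
  case (Suc k)
  \<comment> \<open>The C*-identity squares the norm whenever the exponent doubles.\<close>
  have "y ^ (2 ^ Suc k) = y ^ (2 ^ k) * y ^ (2 ^ k)" by (simp add: mult_2 power_add)
  also have "norm \<dots> = (norm (y ^ (2 ^ k)))\<^sup>2" by (rule norm_mult_self) (simp add: star_power assms)
  finally show ?case by (simp add: Suc power_mult[symmetric] mult.commute)
qed simp

text \<open>Spectrally, \<open>c\<^sup>* c\<close> and \<open>c c\<^sup>*\<close> differ at most by the point \<open>0\<close>. The spectral radius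
  formula replaces that: powers of \<open>1 - c\<^sup>* c\<close> grow at most linearly in norm when those of
  \<open>1 - c c\<^sup>*\<close> are bounded.\<close>

lemma norm_one_minus_swap:
  fixes b :: "'a::unital_cstar_algebra"
  assumes "norm (1 - b * star b) \<le> 1"
  shows "norm (1 - star b * b) \<le> 1"
proof (rule ccontr)
  let ?y = "1 - star b * b" and ?z = "1 - b * star b"
  assume "\<not> norm ?y \<le> 1"
  define d where "d = norm ?y - 1"
  have d: "d > 0" "norm ?y = 1 + d" using \<open>\<not> norm ?y \<le> 1\<close> by (auto simp: d_def)
  have zn: "norm (?z ^ n) \<le> 1" for n
    using norm_power_ineq[of ?z n] power_le_one[of "norm ?z" n] assms by simp
  have yz: "?y ^ n * star b = star b * ?z ^ n" for n
  proof (induction n)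
    case (Suc n)
    have "?y ^ Suc n * star b = ?y ^ n * star b * ?z"
      unfolding power_Suc2 by (simp add: algebra_simps)
    then show ?case using Suc by (simp add: mult.assoc power_commutes)
  qed simp
  have lin: "norm (?y ^ n) \<le> 1 + n * (norm b)\<^sup>2" for n
  proof (induction n)
    case (Suc n)
    have "?y ^ Suc n = ?y ^ n - (?y ^ n * star b) * b"
      unfolding power_Suc2 by (simp add: algebra_simps)
    also have "\<dots> = ?y ^ n - star b * ?z ^ n * b" by (simp only: yz)
    also have "norm \<dots> \<le> norm (?y ^ n) + norm (star b * ?z ^ n * b)" by (rule norm_triangle_ineq4)
    also have "norm (star b * ?z ^ n * b) \<le> norm (star b) * norm (?z ^ n) * norm b"
      by (meson mult_right_mono norm_ge_zero norm_mult_ineq order_trans)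
    also have "\<dots> \<le> norm b * 1 * norm b"
      unfolding norm_star by (intro mult_mono zn) auto
    finally show ?case using Suc by (simp add: algebra_simps power2_eq_square)
  qed simp
  \<comment> \<open>Growth is compared at exponents \<open>2 ^ k\<close> because there
    \<open>norm (?y ^ n)\<close> is known exactly to be \<open>(1 + d) ^ n\<close>.\<close>
  have "\<exists>k. 1 + (2 ^ k) * C < (1 + d) ^ (2 ^ k)" for C :: real
  proof -
    have "(\<lambda>n. (1 + real n * C) / (1 + d) ^ n) \<longlonglongrightarrow> 0"
    proof -
      have q: "norm (inverse (1 + d)) < 1" using d(1) by (simp add: inverse_less_1_iff)
      have "(\<lambda>n. inverse (1 + d) ^ n + C * (real n * inverse (1 + d) ^ n)) \<longlonglongrightarrow> 0 + C * 0"
        using q by (intro tendsto_intros LIMSEQ_power_zero powser_times_n_limit_0) auto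
      then show ?thesis by (simp add: divide_inverse power_inverse algebra_simps)
    qed
    then have "\<forall>\<^sub>F n in sequentially. (1 + real n * C) / (1 + d) ^ n < 1"
      by (rule order_tendstoD) simp
    then obtain N where "\<And>n. n \<ge> N \<Longrightarrow> (1 + real n * C) / (1 + d) ^ n < 1"
      by (auto simp: eventually_sequentially)
    from this[of "2 ^ N"] show ?thesis
      using d less_exp[of N] by (intro exI[of _ N]) (auto simp: divide_less_eq less_imp_le)
  qed
  then obtain k where k: "1 + (2 ^ k) * (norm b)\<^sup>2 < (1 + d) ^ (2 ^ k)" by blast
  have "star ?y = ?y" by (simp add: star_diff star_mult star_star)
  from norm_power_two_power[OF this, of k] lin[of "2 ^ k"] k d show False by simp
qed

text \<open>Scaling by \<open>norm c\<close> turns positivity of the two products into the two norm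
  bounds related by \<open>norm_one_minus_swap\<close>.\<close>

lemma sa_square_swap:
  fixes c :: "'a::unital_cstar_algebra"
  assumes "sa_square (c * star c)"
  shows "sa_square (star c * c)"
proof (cases "c = 0")
  case True
  with assms show ?thesis by simp
next
  case False
  define s where "s = norm c"
  have s: "s > 0" using False by (simp add: s_def)
  define b where "b = (1 / s) *\<^sub>R c"
  have bb: "1 - b * star b = (1 / s\<^sup>2) *\<^sub>R (of_real (s\<^sup>2) - c * star c)"
    "1 - star b * b = (1 / s\<^sup>2) *\<^sub>R (of_real (s\<^sup>2) - star c * c)"
    using s by (simp_all add: b_def star_scaleR scaleR_diff_right of_real_def power2_eq_square)
  have "norm (c * star c) = s\<^sup>2"
    using cstar_identity[of "star c"] by (simp add: star_star s_def)
  with sa_square_near_scalar[OF assms, of "s\<^sup>2"]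
  have "norm (of_real (s\<^sup>2) - c * star c) \<le> s\<^sup>2" by simp
  then have "norm (1 - b * star b) \<le> 1"
    unfolding bb using s by (simp add: divide_le_eq del: of_real_power)
  then have "norm (1 - star b * b) \<le> 1" by (rule norm_one_minus_swap)
  then have "norm (of_real (s\<^sup>2) - star c * c) \<le> s\<^sup>2"
    unfolding bb using s by (simp add: divide_le_eq del: of_real_power)
  then show ?thesis
    by (intro sa_squareI[where s = "s\<^sup>2"]) (simp_all add: star_mult star_star)
qed

text \<open>\<open>c * star c + star c * c\<close> is a sum of two squares. If
  \<open>star c * c\<close> is negative, then \<open>c * star c\<close> is positive, by
  \<open>sa_square_swap\<close> so is \<open>star c * c\<close>, and it must vanish.\<close>

lemma neg_sa_square_imp_0:
  fixes c :: "'a::unital_cstar_algebra"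
  assumes neg: "sa_square (- (star c * c))"
  shows "c = 0"
proof -
  \<comment> \<open>These are \<open>sqrt 2\<close> times the real and imaginary parts of
    \<open>c\<close>.\<close>
  define x y where "x = (1 / sqrt 2) *\<^sub>R (c + star c)" and "y = (1 / sqrt 2) *\<^sub>R (\<i> *\<^sub>C (star c - c))"
  have x: "star x = x"
    by (simp add: x_def star_scaleR star_add star_star add.commute)
  have y: "star y = y"
    by (simp add: y_def star_scaleR star_scaleC star_diff star_star scaleC_diff_right)
       (metis scaleC_minus1 scaleC_minus_right scaleC_scaleC mult_minus1_right minus_diff_eq scaleC_diff_right)
  have xx: "x * x = (1 / 2) *\<^sub>R ((c + star c) * (c + star c))"
    by (simp add: x_def)
  have yy: "y * y = (1 / 2) *\<^sub>R ((c - star c) * (star c - c))"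
  proof -
    have "(\<i> *\<^sub>C (star c - c)) * (\<i> *\<^sub>C (star c - c)) = (c - star c) * (star c - c)"
      by (simp add: mult_scaleC_left mult_scaleC_right scaleC_scaleC scaleC_minus1 del: mult_minus_left)
         (simp add: algebra_simps)
    then show ?thesis by (simp add: y_def)
  qed
  have "x * x + y * y = c * star c + star c * c"
    unfolding xx yy by (simp add: scaleR_add_right[symmetric]) (simp add: algebra_simps flip: scaleR_2)
  then have "c * star c = x * x + y * y + - (star c * c)" by simp
  moreover have "sa_square (x * x + y * y + - (star c * c))"
    using x y by (intro sa_square_add neg) (auto simp: sa_square_def)
  ultimately have "sa_square (star c * c)" using sa_square_swap by metis
  from sa_square_plus_sa_square_eq_0[OF this neg] show ?thesis
    by (simp add: star_mult_self_eq_0)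
qed

text \<open>With \<open>a = b\<^sup>* b\<close> and \<open>p = \<bar>a\<bar>\<close>, the element \<open>m = p - a\<close> is twice the negative part of \<open>a\<close>,
  and \<open>c = b m\<close> satisfies \<open>c\<^sup>* c = - m p m \<le> 0\<close>.\<close>

theorem sa_square_star_mult_self:
  fixes b :: "'a::unital_cstar_algebra"
  shows "sa_square (star b * b)"
proof -
  define a where "a = star b * b"
  have a: "star a = a" by (simp add: a_def star_mult star_star)
  have aa: "sa_square (a * a)" using a by (auto simp: sa_square_def)
  obtain p where p: "star p = p" "a * a = p * p"
    and p': "norm (of_real (sqrt (norm (a * a))) - p) \<le> sqrt (norm (a * a))"
    and commp: "\<And>y. y * (a * a) = (a * a) * y \<Longrightarrow> y * p = p * y"
    using sqrt_near_scalar[OF sa_square_self_adjoint[OF aa] sa_square_near_scalar[OF aa order_refl]]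
    by metis
  obtain r where r: "star r = r" "p = r * r"
    and commr: "\<And>y. y * p = p * y \<Longrightarrow> y * r = r * y"
    using sqrt_near_scalar[OF p(1) p'] by metis
  define m where "m = p - a"
  have ap: "a * p = p * a" by (rule commp) (simp add: mult.assoc)
  have m: "star m = m" by (simp add: m_def star_diff a p)
  have mp: "m * p = p * m" by (simp add: m_def algebra_simps ap)
  have am: "a * m = - (p * m)" by (simp add: m_def algebra_simps ap p)
  have rm: "m * r = r * m" by (rule commr[OF mp])
  have "star (b * m) * (b * m) = m * (a * m)"
    by (simp add: star_mult m a_def mult.assoc)
  also have "\<dots> = - (m * p * m)" by (simp add: am mult.assoc)
  finally have c: "star (b * m) * (b * m) = - (m * p * m)" .
  have "m * p * m = (r * m) * (r * m)"
    unfolding r(2) by (metis mult.assoc rm)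
  moreover have "star (r * m) = r * m" by (simp add: star_mult r m rm)
  ultimately have "sa_square (m * p * m)" by (auto simp: sa_square_def)
  then have "b * m = 0" using neg_sa_square_imp_0[of "b * m"] c by simp
  with c have mpm: "m * p * m = 0" by simp
  \<comment> \<open>Since \<open>a * m = - (p * m)\<close>, this makes \<open>m * (m * m)\<close>
    twice \<open>m * p * m\<close>, hence \<open>0\<close>, and the C*-identity gives
    \<open>m = 0\<close>.\<close>
  have "m * m = p * m + p * m"
  proof -
    have "m * m = p * m - a * m" by (subst (1) m_def) (simp add: algebra_simps)
    then show ?thesis by (simp add: am)
  qed
  then have "m * (m * m) = 0" using mpm by (simp add: distrib_left mult.assoc)
  then have "(m * m) * (m * m) = 0" by (simp add: mult.assoc)
  then have "norm ((m * m) * (m * m)) = 0" by simp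
  then have "m = 0" by (simp add: norm_mult_self m star_mult)
  then have "a = r * r" using r by (simp add: m_def)
  then show ?thesis using r by (auto simp: sa_square_def a_def)
qed

subsection \<open>The unitization\<close>

datatype 'a unitization = Unitization (scal: complex) (elt: 'a)

definition unitization_op :: "'a::cstar_algebra unitization \<Rightarrow> 'a \<Rightarrow> 'a" where
  "unitization_op z c = scal z *\<^sub>C c + elt z * c"

lemma bounded_linear_unitization_op: "bounded_linear (unitization_op z)"
proof (rule bounded_linear_intro)
  show "norm (unitization_op z c) \<le> norm c * (cmod (scal z) + norm (elt z))" for c
    unfolding unitization_op_def
    by (rule order_trans[OF norm_triangle_ineq])
       (simp add: norm_scaleC distrib_left mult.commute norm_mult_ineq[THEN order_trans])
qed (simp_all add: unitization_op_def scaleC_add_right scaleC_scaleR algebra_simps)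

lemma norm_unitization_op_le: "norm (unitization_op z c) \<le> onorm (unitization_op z) * norm c"
  by (rule onorm[OF bounded_linear_unitization_op])

lemma onorm_unitization_op_nonneg: "0 \<le> onorm (unitization_op z)"
  by (rule onorm_pos_le[OF bounded_linear_unitization_op])

text \<open>The maximum makes this a norm even if \<open>'a\<close> already has a unit: the operator norm alone would
  vanish on the difference of the two units.\<close>

instantiation unitization :: (cstar_algebra) real_normed_algebra_1
begin

definition "0 = Unitization 0 0"
definition "1 = Unitization 1 0"
definition "z + w = Unitization (scal z + scal w) (elt z + elt w)"
definition "z - w = Unitization (scal z - scal w) (elt z - elt w)"
definition "- z = Unitization (- scal z) (- elt z)"
definition "z * w = Unitization (scal z * scal w)
  (scal z *\<^sub>C elt w + scal w *\<^sub>C elt z + elt z * elt w)"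
definition "r *\<^sub>R z = Unitization (r *\<^sub>R scal z) (r *\<^sub>R elt z)"
definition "norm z = max (cmod (scal z)) (onorm (unitization_op z))"
definition "sgn z = inverse (norm z) *\<^sub>R z" for z :: "'a unitization"
definition "dist z w = norm (z - w)" for z w :: "'a unitization"
definition [code del]: "(uniformity :: ('a unitization \<times> 'a unitization) filter) =
  (INF e\<in>{0 <..}. principal {(x, y). dist x y < e})"
definition [code del]: "open (U :: 'a unitization set) =
  (\<forall>x\<in>U. eventually (\<lambda>(x', y). x' = x \<longrightarrow> y \<in> U) uniformity)"

lemmas unitization_defs = zero_unitization_def one_unitization_def plus_unitization_def
  minus_unitization_def uminus_unitization_def times_unitization_def scaleR_unitization_def

lemma unitization_op_simps:
  "unitization_op (0 :: 'a unitization) = (\<lambda>c. 0)"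
  "unitization_op (1 :: 'a unitization) = (\<lambda>c. c)"
  "unitization_op (z + w :: 'a unitization) = (\<lambda>c. unitization_op z c + unitization_op w c)"
  "unitization_op (r *\<^sub>R z :: 'a unitization) = (\<lambda>c. r *\<^sub>R unitization_op z c)"
  "unitization_op (z * w :: 'a unitization) = unitization_op z \<circ> unitization_op w"
  by (auto simp: fun_eq_iff unitization_op_def unitization_defs scaleC_add_left scaleC_add_right
      scaleR_scaleC scaleC_scaleC mult_scaleC_left mult_scaleC_right algebra_simps scaleR_conv_of_real)

instance
proof
  fix x y z :: "'a unitization" and r s :: real
  show "x + y + z = x + (y + z)" "x + y = y + x" "0 + x = x" "- x + x = 0" "x - y = x + - y"
    "r *\<^sub>R (x + y) = r *\<^sub>R x + r *\<^sub>R y" "(r + s) *\<^sub>R x = r *\<^sub>R x + s *\<^sub>R x"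
    "r *\<^sub>R s *\<^sub>R x = (r * s) *\<^sub>R x" "1 *\<^sub>R x = x" "(0 :: 'a unitization) \<noteq> 1"
    by (simp_all add: unitization_defs algebra_simps)
  show "x * y * z = x * (y * z)" "(x + y) * z = x * z + y * z" "x * (y + z) = x * y + x * z"
    "(r *\<^sub>R x) * y = r *\<^sub>R (x * y)" "x * (r *\<^sub>R y) = r *\<^sub>R (x * y)" "1 * x = x" "x * 1 = x"
    by (simp_all add: unitization_defs scaleC_add_left scaleC_add_right scaleR_scaleC scaleC_scaleC
        mult_scaleC_left mult_scaleC_right algebra_simps scaleR_conv_of_real)
  show "dist x y = norm (x - y)" by (rule dist_unitization_def)
  show "sgn x = inverse (norm x) *\<^sub>R x" by (rule sgn_unitization_def)
  show "(uniformity :: ('a unitization \<times> 'a unitization) filter) =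
    (INF e\<in>{0 <..}. principal {(x, y). dist x y < e})" by (rule uniformity_unitization_def)
  show "open U = (\<forall>x\<in>U. \<forall>\<^sub>F (x', y) in uniformity. x' = x \<longrightarrow> y \<in> U)" for U :: "'a unitization set"
    by (rule open_unitization_def)
  show "norm x = 0 \<longleftrightarrow> x = 0"
  proof
    assume "norm x = 0"
    then have "scal x = 0" and "onorm (unitization_op x) = 0"
      using onorm_unitization_op_nonneg[of x] by (auto simp: norm_unitization_def max_def split: if_splits)
    then have "elt x * star (elt x) = 0"
      using onorm_eq_0[OF bounded_linear_unitization_op, of x] by (simp add: unitization_op_def)
    then have "elt x = 0"
      using star_mult_self_eq_0[of "star (elt x)"] by (metis norm_eq_zero norm_star star_star)
    with \<open>scal x = 0\<close> show "x = 0" by (simp add: zero_unitization_def unitization.expand)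
  next
    assume "x = 0"
    then show "norm x = 0"
      by (simp only: norm_unitization_def unitization_op_simps) (simp add: zero_unitization_def onorm_zero)
  qed
  show "norm (x + y) \<le> norm x + norm y"
    using norm_triangle_ineq[of "scal x" "scal y"]
      onorm_triangle[OF bounded_linear_unitization_op bounded_linear_unitization_op, of x y]
    unfolding norm_unitization_def unitization_op_simps by (auto simp: plus_unitization_def)
  show "norm (r *\<^sub>R x) = \<bar>r\<bar> * norm x"
    using onorm_scaleR[OF bounded_linear_unitization_op, of r x]
    unfolding norm_unitization_def unitization_op_simps
    by (simp add: scaleR_unitization_def max_mult_distrib_left)
  show "norm (x * y) \<le> norm x * norm y"
  proof -
    have "onorm (unitization_op (x * y)) \<le> onorm (unitization_op x) * onorm (unitization_op y)"
      unfolding unitization_op_simps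
      by (intro onorm_compose bounded_linear_unitization_op)
    also have "\<dots> \<le> norm x * norm y"
      by (intro mult_mono) (auto simp: norm_unitization_def onorm_unitization_op_nonneg le_max_iff_disj)
    finally have 1: "onorm (unitization_op (x * y)) \<le> norm x * norm y" .
    have "cmod (scal x) * cmod (scal y) \<le> norm x * norm y"
      by (intro mult_mono) (auto simp: norm_unitization_def le_max_iff_disj)
    then show ?thesis
      unfolding norm_unitization_def[of "x * y"] using 1 by (simp add: times_unitization_def norm_mult)
  qed
  have "onorm (unitization_op (1 :: 'a unitization)) \<le> 1"
    unfolding unitization_op_simps by (rule onorm_bound) auto
  then show "norm (1 :: 'a unitization) = 1"
    by (simp add: norm_unitization_def one_unitization_def max_def)
qed

end

definition of_cstar :: "'a::cstar_algebra \<Rightarrow> 'a unitization" where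
  "of_cstar a = Unitization 0 a"

lemma of_cstar_add: "of_cstar (a + b) = of_cstar a + of_cstar b"
  and of_cstar_diff: "of_cstar (a - b) = of_cstar a - of_cstar b"
  and of_cstar_mult: "of_cstar (a * b) = of_cstar a * of_cstar b"
  and of_cstar_scaleR: "of_cstar (r *\<^sub>R a) = r *\<^sub>R of_cstar a"
  by (simp_all add: of_cstar_def unitization_defs)

text \<open>Left multiplication by \<open>a\<close> has norm at least \<open>norm a\<close>, as its
  value at \<open>star a\<close> shows via the C*-identity.\<close>

lemma norm_of_cstar [simp]: "norm (of_cstar a) = norm a"
proof -
  have "onorm (unitization_op (of_cstar a)) \<le> norm a"
    by (rule onorm_bound) (simp_all add: unitization_op_def of_cstar_def norm_mult_ineq)
  moreover have "norm a \<le> onorm (unitization_op (of_cstar a))"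
  proof (cases "a = 0")
    case False
    have "norm a * norm a \<le> onorm (unitization_op (of_cstar a)) * norm a"
      using norm_unitization_op_le[of "of_cstar a" "star a"] cstar_identity[of "star a"]
      by (simp add: unitization_op_def of_cstar_def star_star power2_eq_square)
    with False show ?thesis by simp
  qed (simp add: onorm_unitization_op_nonneg)
  ultimately have "onorm (unitization_op (of_cstar a)) = norm a" by simp
  then show ?thesis by (simp add: norm_unitization_def) (simp add: of_cstar_def)
qed

lemma unitization_decomp: "z = of_cstar (elt z) + Unitization (scal z) 0"
  by (simp add: of_cstar_def plus_unitization_def)

lemma norm_unitization_scalar: "norm (Unitization l (0::'a::cstar_algebra)) = cmod l"
proof -
  have "onorm (unitization_op (Unitization l (0::'a))) \<le> cmod l"
    by (rule onorm_bound) (simp_all add: unitization_op_def norm_scaleC)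
  then show ?thesis by (simp add: norm_unitization_def)
qed

text \<open>Both coordinates are controlled by the norm, so limits can be taken coordinatewise. The
  factor \<open>2\<close> below arises because \<open>elt z\<close> is \<open>z\<close> minus its
  scalar part.\<close>

instance unitization :: (cstar_algebra) banach
proof
  fix X :: "nat \<Rightarrow> 'a unitization"
  assume X: "Cauchy X"
  have scal_le: "cmod (scal z) \<le> norm z" for z :: "'a unitization"
    by (simp add: norm_unitization_def)
  have elt_le: "norm (elt z) \<le> 2 * norm z" for z :: "'a unitization"
  proof -
    have "of_cstar (elt z) = z - Unitization (scal z) 0"
      using unitization_decomp[of z] by (simp add: eq_diff_eq)
    then have "norm (elt z) \<le> norm z + cmod (scal z)"
      by (metis norm_of_cstar norm_triangle_ineq4 norm_unitization_scalar)
    then show ?thesis using scal_le[of z] by simp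
  qed
  have "Cauchy (\<lambda>n. scal (X n))"
  proof (rule CauchyI)
    fix e :: real assume "e > 0"
    then obtain M where M: "\<forall>m\<ge>M. \<forall>n\<ge>M. norm (X m - X n) < e" using CauchyD[OF X] by blast
    have "norm (scal (X m) - scal (X n)) < e" if "m \<ge> M" "n \<ge> M" for m n
      using scal_le[of "X m - X n"] M that by (fastforce simp: minus_unitization_def)
    then show "\<exists>M. \<forall>m\<ge>M. \<forall>n\<ge>M. norm (scal (X m) - scal (X n)) < e" by blast
  qed
  then obtain l where l: "(\<lambda>n. scal (X n)) \<longlonglongrightarrow> l" by (auto simp: Cauchy_convergent_iff convergent_def)
  have "Cauchy (\<lambda>n. elt (X n))"
  proof (rule CauchyI)
    fix e :: real assume "e > 0"
    then obtain M where M: "\<forall>m\<ge>M. \<forall>n\<ge>M. norm (X m - X n) < e / 2"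
      using CauchyD[OF X, of "e / 2"] by auto
    have "norm (elt (X m) - elt (X n)) < e" if "m \<ge> M" "n \<ge> M" for m n
      using elt_le[of "X m - X n"] M that by (fastforce simp: minus_unitization_def)
    then show "\<exists>M. \<forall>m\<ge>M. \<forall>n\<ge>M. norm (elt (X m) - elt (X n)) < e" by blast
  qed
  then obtain a where a: "(\<lambda>n. elt (X n)) \<longlonglongrightarrow> a" by (auto simp: Cauchy_convergent_iff convergent_def)
  have le: "norm (X n - Unitization l a) \<le> norm (elt (X n) - a) + cmod (scal (X n) - l)" for n
  proof -
    have "X n - Unitization l a = of_cstar (elt (X n) - a) + Unitization (scal (X n) - l) 0"
      by (simp add: of_cstar_def minus_unitization_def plus_unitization_def)
    then show ?thesis
      by (metis norm_of_cstar norm_triangle_ineq norm_unitization_scalar)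
  qed
  have "(\<lambda>n. norm (elt (X n) - a) + cmod (scal (X n) - l)) \<longlonglongrightarrow> 0"
    using tendsto_add[OF tendsto_norm_zero[OF LIM_zero[OF a]] tendsto_norm_zero[OF LIM_zero[OF l]]] by simp
  then have "(\<lambda>n. norm (X n - Unitization l a)) \<longlonglongrightarrow> 0"
    by (rule Lim_null_comparison[rotated]) (simp add: le)
  then have "X \<longlonglongrightarrow> Unitization l a"
    by (rule LIM_zero_cancel[OF tendsto_norm_zero_cancel])
  then show "convergent X" by (auto simp: convergent_def)
qed

instantiation unitization :: (cstar_algebra) unital_cstar_algebra
begin

definition "c *\<^sub>C z = Unitization (c * scal z) (c *\<^sub>C elt z)"
definition "star z = Unitization (cnj (scal z)) (star (elt z))"

text \<open>The vector \<open>unitization_op z c\<close> lies in \<open>'a\<close>, so its norm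
  obeys the C*-identity there; this formula brings in \<open>star z * z\<close>.\<close>

lemma star_unitization_op:
  "star (unitization_op z c) * unitization_op z c = star c * unitization_op (star z * z) c"
  by (simp add: unitization_op_def star_unitization_def times_unitization_def star_add star_scaleC
      star_mult algebra_simps scaleC_add_left scaleC_add_right scaleC_scaleC mult_scaleC_left
      mult_scaleC_right)

instance
proof
  fix x y :: "'a unitization" and c d :: complex and r :: real
  show "c *\<^sub>C (x + y) = c *\<^sub>C x + c *\<^sub>C y" "(c + d) *\<^sub>C x = c *\<^sub>C x + d *\<^sub>C x"
    "c *\<^sub>C d *\<^sub>C x = (c * d) *\<^sub>C x"
    by (simp_all add: scaleC_unitization_def plus_unitization_def scaleC_add_left scaleC_add_right
        scaleC_scaleC algebra_simps)
  show "r *\<^sub>R x = complex_of_real r *\<^sub>C x"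
    by (simp add: scaleC_unitization_def scaleR_unitization_def scaleR_scaleC scaleR_conv_of_real)
  have one: "norm (c *\<^sub>C x) \<le> cmod c * norm x" for c and x :: "'a unitization"
  proof -
    have "c *\<^sub>C x = Unitization c 0 * x" by (simp add: scaleC_unitization_def times_unitization_def)
    then show ?thesis by (metis norm_mult_ineq norm_unitization_scalar)
  qed
  show "norm (c *\<^sub>C x) = cmod c * norm x"
  proof (cases "c = 0")
    case True
    with one[of c x] show ?thesis by simp
  next
    case False
    then have "x = inverse c *\<^sub>C c *\<^sub>C x"
      by (simp add: scaleC_unitization_def scaleC_scaleC flip: mult.assoc)
    then have "cmod c * norm x \<le> cmod c * (cmod (inverse c) * norm (c *\<^sub>C x))"
      by (metis one mult_left_mono norm_ge_zero)
    also have "\<dots> = norm (c *\<^sub>C x)" using False by (simp add: norm_inverse)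
    finally show ?thesis using one[of c x] by simp
  qed
  show "(c *\<^sub>C x) * y = c *\<^sub>C (x * y)" "x * (c *\<^sub>C y) = c *\<^sub>C (x * y)"
    by (simp_all add: scaleC_unitization_def times_unitization_def scaleC_add_right scaleC_scaleC
        mult_scaleC_left mult_scaleC_right mult_ac)
  show "star (star x) = x" by (simp add: star_unitization_def star_star)
  show "star (x + y) = star x + star y" by (simp add: star_unitization_def plus_unitization_def star_add)
  show "star (c *\<^sub>C x) = cnj c *\<^sub>C star x"
    by (simp add: star_unitization_def scaleC_unitization_def star_scaleC)
  show "star (x * y) = star y * star x"
    by (simp add: star_unitization_def times_unitization_def star_add star_scaleC star_mult mult.commute
        add_ac)
  \<comment> \<open>The operator part is bounded through the C*-identity of \<open>'a\<close>, the
    scalar part through that of the complex numbers.\<close>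
  have ge: "(norm z)\<^sup>2 \<le> norm (star z * z)" for z :: "'a unitization"
  proof -
    let ?N = "norm (star z * z)"
    have "norm (unitization_op z c) \<le> sqrt ?N * norm c" for c
    proof -
      have "(norm (unitization_op z c))\<^sup>2 = norm (star c * unitization_op (star z * z) c)"
        by (simp add: cstar_identity[symmetric] star_unitization_op)
      also have "\<dots> \<le> norm (star c) * norm (unitization_op (star z * z) c)" by (rule norm_mult_ineq)
      also have "\<dots> \<le> norm c * (?N * norm c)"
        using norm_unitization_op_le[of "star z * z" c]
        by (auto simp: norm_unitization_def intro!: mult_left_mono elim!: order_trans intro: mult_right_mono)
      also have "\<dots> = (sqrt ?N * norm c)\<^sup>2" by (simp add: power2_eq_square)
      finally show ?thesis by (rule power2_le_imp_le) simp
    qed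
    then have "onorm (unitization_op z) \<le> sqrt ?N" by (intro onorm_bound) auto
    moreover have "cmod (scal z) \<le> sqrt ?N"
    proof (rule real_le_rsqrt)
      have "(cmod (scal z))\<^sup>2 = cmod (scal (star z * z))"
        by (simp add: star_unitization_def times_unitization_def norm_mult power2_eq_square)
      then show "(cmod (scal z))\<^sup>2 \<le> ?N" by (simp add: norm_unitization_def)
    qed
    ultimately have "norm z \<le> sqrt ?N" by (simp add: norm_unitization_def)
    then have "(norm z)\<^sup>2 \<le> (sqrt ?N)\<^sup>2" by (intro power_mono) auto
    then show ?thesis by simp
  qed
  have star_le: "norm z \<le> norm (star z)" for z :: "'a unitization"
  proof (cases "z = 0")
    case False
    have "norm z * norm z \<le> norm (star z) * norm z"
      using ge[of z] norm_mult_ineq[of "star z" z] by (simp add: power2_eq_square)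
    with False show ?thesis by simp
  qed simp
  have "norm (star x) \<le> norm x"
    using star_le[of "star x"] by (simp add: star_unitization_def star_star)
  then have "norm (star x * x) \<le> (norm x)\<^sup>2"
    unfolding power2_eq_square by (meson mult_right_mono norm_ge_zero norm_mult_ineq order_trans)
  with ge[of x] show "norm (star x * x) = (norm x)\<^sup>2" by simp
qed

end

lemma of_cstar_star: "of_cstar (star a) = star (of_cstar a)"
  by (simp add: of_cstar_def star_unitization_def)

subsection \<open>The order of a C*-algebra\<close>

text \<open>The difference is judged in the unitization, where comparison with scalars makes
  sense.\<close>

definition cstar_le :: "'a::cstar_algebra \<Rightarrow> 'a \<Rightarrow> bool"  (infix "\<preceq>" 50) where
  "a \<preceq> b \<longleftrightarrow> sa_square (of_cstar (b - a))"

lemma zero_le_star_mult_self: "0 \<preceq> star b * b"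
  by (simp add: cstar_le_def of_cstar_mult of_cstar_star sa_square_star_mult_self)

lemma cstar_positive_imp_zero_le: "cstar_positive a \<Longrightarrow> 0 \<preceq> a"
  by (auto simp: cstar_positive_def zero_le_star_mult_self)

lemma cstar_le_iff_diff: "a \<preceq> b \<longleftrightarrow> 0 \<preceq> b - a"
  by (simp add: cstar_le_def)

lemma cstar_le_refl [simp]: "a \<preceq> a"
  using zero_le_star_mult_self[of 0] by (simp add: cstar_le_def)

lemma cstar_le_add_mono: "a \<preceq> b \<Longrightarrow> c \<preceq> d \<Longrightarrow> a + c \<preceq> b + d"
  using sa_square_add[of "of_cstar (b - a)" "of_cstar (d - c)"]
  by (simp add: cstar_le_def add_diff_add flip: of_cstar_add)

lemma cstar_le_trans [trans]: "a \<preceq> b \<Longrightarrow> b \<preceq> c \<Longrightarrow> a \<preceq> c"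
  using cstar_le_add_mono[of a b b c] by (simp add: cstar_le_def)

lemma cstar_le_sum: "(\<And>i. i \<in> F \<Longrightarrow> f i \<preceq> g i) \<Longrightarrow> sum f F \<preceq> sum g F"
  by (induction F rule: infinite_finite_induct) (simp_all add: cstar_le_add_mono)

lemma cstar_sum_nonneg: "(\<And>i. i \<in> F \<Longrightarrow> 0 \<preceq> f i) \<Longrightarrow> 0 \<preceq> sum f F"
  using cstar_le_sum[of F "\<lambda>_. 0" f] by simp

lemma cstar_le_scaleR:
  assumes "a \<preceq> b" "0 \<le> r"
  shows "r *\<^sub>R a \<preceq> r *\<^sub>R b"
proof -
  obtain h where h: "star h = h" "of_cstar (b - a) = h * h"
    using assms by (auto simp: cstar_le_def sa_square_def)
  have "of_cstar (r *\<^sub>R b - r *\<^sub>R a) = r *\<^sub>R of_cstar (b - a)"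
    by (simp add: of_cstar_scaleR scaleR_diff_right flip: of_cstar_scaleR)
  also have "\<dots> = (sqrt r *\<^sub>R h) * (sqrt r *\<^sub>R h)"
    using \<open>0 \<le> r\<close> by (simp add: h)
  finally show ?thesis
    unfolding cstar_le_def sa_square_def by (intro exI[of _ "sqrt r *\<^sub>R h"]) (simp add: star_scaleR h)
qed

lemma norm_mono: "0 \<preceq> a \<Longrightarrow> a \<preceq> b \<Longrightarrow> norm a \<le> norm b"
  using sa_square_norm_mono[of "of_cstar a" "of_cstar b"] by (simp add: cstar_le_def of_cstar_diff)

text \<open>In the unitization, \<open>t - a\<close> is a square \<open>h * h\<close>, and the
  difference of both sides becomes \<open>star (h * c) * (h * c)\<close>.\<close>

lemma conj_le_norm:
  assumes "star a = a" "norm a \<le> t"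
  shows "star c * a * c \<preceq> t *\<^sub>R (star c * c)"
proof -
  have "sa_square (of_real t - of_cstar a)"
    using assms by (intro sa_square_norm_minus) (simp_all flip: of_cstar_star)
  then obtain h where h: "star h = h" "of_real t - of_cstar a = h * h"
    by (auto simp: sa_square_def)
  have "of_cstar (t *\<^sub>R (star c * c) - star c * a * c)
      = star (of_cstar c) * (of_real t - of_cstar a) * of_cstar c"
    by (simp add: of_cstar_diff of_cstar_mult of_cstar_scaleR of_cstar_star of_real_def algebra_simps)
  also have "\<dots> = star (h * of_cstar c) * (h * of_cstar c)"
    by (simp add: h star_mult mult.assoc)
  finally show ?thesis by (simp add: cstar_le_def sa_square_star_mult_self)
qed

text \<open>Convexity of the square, without commutation: for \<open>N = card K\<close> and
  \<open>s = sum a K\<close>, the squares of \<open>N *\<^sub>R a k - s\<close> add up to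
  \<open>N\<close> times the difference of the two sides.\<close>

lemma sum_square_le:
  fixes a :: "'i \<Rightarrow> 'a::cstar_algebra"
  assumes K: "finite K" and a: "\<And>k. k \<in> K \<Longrightarrow> star (a k) = a k"
  shows "sum a K * sum a K \<preceq> real (card K) *\<^sub>R (\<Sum>k\<in>K. a k * a k)"
proof (cases "K = {}")
  case False
  define N where "N = real (card K)"
  define s where "s = sum a K"
  have N: "N > 0" using K False by (simp add: N_def card_gt_0_iff)
  have s: "star s = s" by (simp add: s_def star_sum a)
  have "0 \<preceq> (\<Sum>k\<in>K. star (N *\<^sub>R a k - s) * (N *\<^sub>R a k - s))"
    by (intro cstar_sum_nonneg zero_le_star_mult_self)
  also have "(\<Sum>k\<in>K. star (N *\<^sub>R a k - s) * (N *\<^sub>R a k - s))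
      = (\<Sum>k\<in>K. (N * N) *\<^sub>R (a k * a k) - N *\<^sub>R (a k * s) - N *\<^sub>R (s * a k) + s * s)"
    by (intro sum.cong) (simp_all add: a s star_diff star_scaleR algebra_simps)
  also have "\<dots> = (N * N) *\<^sub>R (\<Sum>k\<in>K. a k * a k) - N *\<^sub>R (s * s) - N *\<^sub>R (s * s) + N *\<^sub>R (s * s)"
    by (simp add: sum.distrib sum_subtractf scaleR_right.sum[symmetric] sum_distrib_left[symmetric]
        sum_distrib_right[symmetric] s_def[symmetric] N_def sum_constant_scaleR)
  finally have "0 \<preceq> (N * N) *\<^sub>R (\<Sum>k\<in>K. a k * a k) - N *\<^sub>R (s * s)" by simp
  from cstar_le_scaleR[OF this, of "1 / N"] N
  have "0 \<preceq> N *\<^sub>R (\<Sum>k\<in>K. a k * a k) - s * s" by (simp add: scaleR_diff_right)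
  then show ?thesis by (simp add: cstar_le_iff_diff[of "_ * _"] N_def s_def)
qed simp

text \<open>Take \<open>N\<close> indices at which the drop is a square. Telescoping bounds the sum
  of these squares by \<open>a 0\<close>, hence the squared norm of the sum of these
  \<open>a k\<close> by \<open>N * norm (a 0)\<close>. Beyond them \<open>N *\<^sub>R a m\<close>
  lies below that sum, so \<open>N * (norm (a m))\<^sup>2 \<le> norm (a 0)\<close>.\<close>

lemma decreasing_by_square_tendsto_0:
  fixes a :: "nat \<Rightarrow> 'a::cstar_algebra"
  assumes sa: "\<And>k. star (a k) = a k" and pos: "\<And>k. 0 \<preceq> a k" and dec: "\<And>k. a (Suc k) \<preceq> a k"
    and inf: "infinite {k. a k - a (Suc k) = a k * a k}"
  shows "a \<longlonglongrightarrow> 0"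
proof (rule LIMSEQ_I)
  fix e :: real assume e: "e > 0"
  have anti: "a n \<preceq> a m" if "m \<le> n" for m n
    using that by (induction n rule: dec_induct) (auto intro: cstar_le_trans dec)
  \<comment> \<open>Makes \<open>norm (a 0) / N\<close> smaller than
    \<open>e\<^sup>2\<close>.\<close>
  obtain N :: nat where N: "norm (a 0) / e\<^sup>2 < N" using reals_Archimedean2 by blast
  have N0: "N > 0"
  proof (rule ccontr)
    assume "\<not> N > 0"
    then show False using N by (simp add: divide_less_0_iff)
  qed
  obtain K where K: "finite K" "card K = N" "K \<subseteq> {k. a k - a (Suc k) = a k * a k}"
    using infinite_arbitrarily_large[OF inf] by blast
  obtain n where n: "\<And>k. k \<in> K \<Longrightarrow> k < n" using K(1) finite_nat_set_iff_bounded by auto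
  have "norm (a m - 0) < e" if "m \<ge> n" for m
  proof -
    have zero: "0 \<preceq> sum (\<lambda>k. star (a k) * a k) K"
      by (intro cstar_sum_nonneg zero_le_star_mult_self)
    have d: "0 \<preceq> a k - a (Suc k)" for k using dec[of k] by (simp add: cstar_le_def)
    have "(\<Sum>k\<in>K. a k * a k) = (\<Sum>k\<in>K. a k - a (Suc k))"
      using K by (intro sum.cong) auto
    moreover have "0 \<preceq> (\<Sum>k\<in>{..<n} - K. a k - a (Suc k))"
      by (intro cstar_sum_nonneg d)
    moreover have "(\<Sum>k<n. a k - a (Suc k))
        = (\<Sum>k\<in>{..<n} - K. a k - a (Suc k)) + (\<Sum>k\<in>K. a k - a (Suc k))"
      using n by (intro sum.subset_diff) auto
    ultimately have "(\<Sum>k\<in>K. a k * a k) \<preceq> (\<Sum>k<n. a k - a (Suc k))"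
      by (simp add: cstar_le_def)
    moreover have "(\<Sum>k<n. a k - a (Suc k)) \<preceq> a 0"
      using pos[of n] by (simp add: sum_lessThan_telescope' cstar_le_def)
    ultimately have "(\<Sum>k\<in>K. a k * a k) \<preceq> a 0" by (rule cstar_le_trans)
    then have sq: "norm (\<Sum>k\<in>K. a k * a k) \<le> norm (a 0)"
      using zero by (intro norm_mono) (simp_all add: sa)
    have sS: "star (sum a K) = sum a K" by (simp add: star_sum sa)
    have "0 \<preceq> sum a K * sum a K" using zero_le_star_mult_self[of "sum a K"] by (simp add: sS)
    then have "norm (sum a K * sum a K) \<le> norm (real N *\<^sub>R (\<Sum>k\<in>K. a k * a k))"
      using sum_square_le[OF K(1), of a] K(2) sa by (intro norm_mono) auto
    then have S: "(norm (sum a K))\<^sup>2 \<le> N * norm (a 0)"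
      using sq mult_left_mono[OF sq, of "real N"] by (simp add: norm_mult_self[OF sS])
    have "(\<Sum>k\<in>K. a m) \<preceq> sum a K"
      using n \<open>m \<ge> n\<close> by (intro cstar_le_sum anti) (meson less_imp_le order_trans)
    then have "real N *\<^sub>R a m \<preceq> sum a K" by (simp add: sum_constant_scaleR K(2))
    moreover have "0 \<preceq> real N *\<^sub>R a m" using cstar_le_scaleR[OF pos[of m], of "real N"] by simp
    ultimately have "norm (real N *\<^sub>R a m) \<le> norm (sum a K)" by (intro norm_mono)
    then have "(N * norm (a m))\<^sup>2 \<le> (norm (sum a K))\<^sup>2" by (intro power_mono) auto
    also note S
    finally have "(N * norm (a m))\<^sup>2 \<le> N * norm (a 0)" .
    then have "N * (norm (a m))\<^sup>2 \<le> norm (a 0)"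
      using N0 by (simp add: power2_eq_square mult_ac)
    also have "\<dots> < N * e\<^sup>2" using N e by (simp add: divide_less_eq)
    finally have "(norm (a m))\<^sup>2 < e\<^sup>2" using N0 by simp
    then show ?thesis using e by (simp add: power_less_imp_less_base)
  qed
  then show "\<exists>n. \<forall>m\<ge>n. norm (a m - 0) < e" by blast
qed

subsection \<open>Positive contractions on a Hilbert module\<close>

context right_hilbert_module
begin

lemma ip_zero_right [simp]: "ip x 0 = 0"
  using ip_add_right[of x 0 0] by simp

lemma ip_minus_right: "ip x (- y) = - ip x y"
  using ip_add_right[of x y "- y"] by (simp add: eq_neg_iff_add_eq_0 add.commute)

lemma ip_diff_right: "ip x (y - z) = ip x y - ip x z"
  using ip_add_right[of x y "- z"] by (simp add: ip_minus_right)

lemma ip_diff_left: "ip (x - y) z = ip x z - ip y z"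
  by (metis ip_diff_right star_diff star_ip)

lemma ip_scaleR_right: "ip x (r *\<^sub>R y) = r *\<^sub>R ip x y"
  by (simp add: scaleR_scaleC ip_scaleC_right)

lemma ip_scaleR_left: "ip (r *\<^sub>R x) y = r *\<^sub>R ip x y"
  by (metis ip_scaleR_right star_ip star_scaleR)

lemma ip_act_left: "ip (x \<cdot> a) y = star a * ip x y"
  by (metis ip_act_right star_ip star_mult)

lemma ip_sum_right: "ip x (sum f F) = (\<Sum>i\<in>F. ip x (f i))"
  by (induction F rule: infinite_finite_induct) (simp_all add: ip_add_right)

lemma ip_sum_left: "ip (sum f F) x = (\<Sum>i\<in>F. ip (f i) x)"
  by (metis (no_types, lifting) ip_sum_right star_ip star_sum sum.cong)

lemma zero_le_ip: "0 \<preceq> ip x x"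
  by (rule cstar_positive_imp_zero_le[OF ip_positive])

lemma norm_ip_self: "norm (ip x x) = (norm x)\<^sup>2"
  by (simp add: norm_eq)

lemma ip_eqI: "(\<And>z. ip z x = ip z y) \<Longrightarrow> x = y"
  using norm_ip_self[of "x - y"] by (simp add: ip_diff_right)

text \<open>The operator order \<open>0 \<le> T \<le> 1\<close>, read off the quadratic form
  \<open>ip x (T x)\<close>; linearity is derived from symmetry.\<close>

definition positive_contraction :: "('x \<Rightarrow> 'x) \<Rightarrow> bool" where
  "positive_contraction T \<longleftrightarrow> (\<forall>x y. ip (T x) y = ip x (T y)) \<and>
     (\<forall>x. 0 \<preceq> ip x (T x)) \<and> (\<forall>x. ip x (T x) \<preceq> ip x x)"

lemma positive_contraction_sym: "positive_contraction T \<Longrightarrow> ip (T x) y = ip x (T y)"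
  by (simp add: positive_contraction_def)

lemma positive_contraction_star: "positive_contraction T \<Longrightarrow> star (ip x (T x)) = ip x (T x)"
  by (simp add: star_ip positive_contraction_sym)

text \<open>Symmetry moves \<open>T\<close> to the other argument of the inner product, which is
  linear in the second; vectors with equal inner products agree.\<close>

lemma positive_contraction_linear:
  assumes "positive_contraction T"
  shows "T (x + y) = T x + T y" "T (x - y) = T x - T y" "T (c *\<^sub>C x) = c *\<^sub>C T x"
    "T (r *\<^sub>R x) = r *\<^sub>R T x" "T (x \<cdot> a) = T x \<cdot> a" "T 0 = 0"
  by (rule ip_eqI, simp add: positive_contraction_sym[OF assms, symmetric] ip_add_right ip_diff_right
      ip_scaleC_right ip_scaleR_right ip_act_right)+

text \<open>Positivity of the form at \<open>t *\<^sub>R x - y \<cdot> c\<close> with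
  \<open>c = ip y (T x)\<close>. By \<open>conj_le_norm\<close> the term
  \<open>star c * ip y (T y) * c\<close> is at most \<open>t *\<^sub>R (star c * c)\<close>, which
  leaves \<open>t\<close> times the claim.\<close>

lemma positive_contraction_Cauchy_Schwarz:
  assumes T: "positive_contraction T" and t: "0 < t" "norm (ip y (T y)) \<le> t"
  shows "star (ip y (T x)) * ip y (T x) \<preceq> t *\<^sub>R ip x (T x)"
proof -
  define c where "c = ip y (T x)"
  define z where "z = t *\<^sub>R x - y \<cdot> c"
  have xy: "ip x (T y) = star c"
    by (simp add: c_def star_ip positive_contraction_sym[OF T])
  have Tz: "T z = t *\<^sub>R T x - T y \<cdot> c"
    by (simp add: z_def positive_contraction_linear[OF T])
  have "ip z (T z) = (t * t) *\<^sub>R ip x (T x) - (2 * t) *\<^sub>R (star c * c) + star c * ip y (T y) * c"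
    unfolding Tz unfolding z_def
    by (simp add: ip_diff_left ip_diff_right ip_scaleR_left ip_scaleR_right ip_act_left ip_act_right xy
        c_def[symmetric] algebra_simps scaleR_2 flip: scaleR_scaleR)
  then have "0 \<preceq> (t * t) *\<^sub>R ip x (T x) - (2 * t) *\<^sub>R (star c * c) + star c * ip y (T y) * c"
    using T by (metis positive_contraction_def)
  also have "\<dots> \<preceq> (t * t) *\<^sub>R ip x (T x) - (2 * t) *\<^sub>R (star c * c) + t *\<^sub>R (star c * c)"
    using conj_le_norm[OF positive_contraction_star[OF T] t(2)]
    by (intro cstar_le_add_mono cstar_le_refl)
  finally have "0 \<preceq> (t * t) *\<^sub>R ip x (T x) - t *\<^sub>R (star c * c)"
    by (simp add: algebra_simps scaleR_2 flip: scaleR_scaleR)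
  from cstar_le_scaleR[OF this, of "1 / t"] t(1) show ?thesis
    by (simp add: scaleR_diff_right cstar_le_iff_diff[of "_ * _"] c_def)
qed

lemma norm_ip_le: "norm (ip y x) \<le> norm y * norm x"
proof (cases "y = 0")
  case True
  then have "ip y x = 0" by (metis ip_zero_right star_0 star_ip)
  then show ?thesis by simp
next
  case False
  have id: "positive_contraction (\<lambda>x. x)" by (simp add: positive_contraction_def zero_le_ip)
  have "star (ip y x) * ip y x \<preceq> (norm y)\<^sup>2 *\<^sub>R ip x x"
    using False by (intro positive_contraction_Cauchy_Schwarz[OF id]) (simp_all add: norm_ip_self)
  from norm_mono[OF zero_le_star_mult_self this] have "(norm (ip y x))\<^sup>2 \<le> (norm y * norm x)\<^sup>2"
    by (simp add: cstar_identity norm_ip_self power_mult_distrib)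
  then show ?thesis by (rule power2_le_imp_le) simp
qed

text \<open>Cauchy-Schwarz with \<open>y = T x\<close> and \<open>t = (norm y)\<^sup>2\<close>: here
  \<open>T \<le> 1\<close> bounds \<open>ip y (T y)\<close>, and a factor \<open>t\<close> cancels
  from \<open>t * t \<le> t * norm (ip x (T x))\<close>.\<close>

lemma norm_positive_contraction_square_le:
  assumes T: "positive_contraction T"
  shows "(norm (T x))\<^sup>2 \<le> norm (ip x (T x))"
proof (cases "T x = 0")
  case False
  define y where "y = T x"
  define t where "t = (norm y)\<^sup>2"
  have t: "t > 0" using False by (simp add: t_def y_def)
  have yy: "ip y (T x) = ip y y" by (simp add: y_def)
  have "norm (ip y (T y)) \<le> norm (ip y y)"
    using T by (intro norm_mono) (auto simp: positive_contraction_def)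
  then have "star (ip y (T x)) * ip y (T x) \<preceq> t *\<^sub>R ip x (T x)"
    by (intro positive_contraction_Cauchy_Schwarz T t) (simp add: norm_ip_self t_def)
  then have "norm (star (ip y y) * ip y y) \<le> norm (t *\<^sub>R ip x (T x))"
    unfolding yy by (intro norm_mono zero_le_star_mult_self)
  then have "t * t \<le> t * norm (ip x (T x))"
    using t by (simp add: cstar_identity norm_ip_self flip: t_def) (simp add: power2_eq_square)
  then have "t \<le> norm (ip x (T x))" using t by simp
  then show ?thesis by (simp add: t_def y_def)
qed simp

lemma norm_positive_contraction_le:
  assumes T: "positive_contraction T"
  shows "norm (T x) \<le> norm x"
proof -
  have "(norm (T x))\<^sup>2 \<le> norm (ip x (T x))"
    by (rule norm_positive_contraction_square_le[OF T])
  also have "\<dots> \<le> norm (ip x x)"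
    using T by (intro norm_mono) (auto simp: positive_contraction_def)
  finally have "(norm (T x))\<^sup>2 \<le> (norm x)\<^sup>2" unfolding norm_ip_self .
  then show ?thesis by (rule power2_le_imp_le) simp
qed

section \<open>The residual operators of the matching pursuit\<close>

primrec residual :: "(nat \<Rightarrow> 'x) \<Rightarrow> nat \<Rightarrow> 'x \<Rightarrow> 'x" where
  "residual v 0 = (\<lambda>x. x)"
| "residual v (Suc n) = (\<lambda>x. residual v n x - residual v n (v n) \<cdot> ip (residual v n (v n)) x)"

lemma ip_rank_one: "ip x (u \<cdot> ip u x) = star (ip u x) * ip u x"
  by (simp add: ip_act_right star_ip)

text \<open>With \<open>y = v n\<close> and \<open>t = 1\<close>, Cauchy-Schwarz shows that the
  subtracted rank-one form is at most \<open>ip x (T x)\<close>; hence positivity survives the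
  subtraction.\<close>

lemma positive_contraction_residual:
  assumes v: "\<And>n. norm (v n) \<le> 1"
  shows "positive_contraction (residual v n)"
proof (induction n)
  case 0
  show ?case by (simp add: positive_contraction_def zero_le_ip)
next
  case (Suc n)
  define T u where "T = residual v n" and "u = T (v n)"
  have T: "positive_contraction T" using Suc by (simp add: T_def)
  have S: "residual v (Suc n) = (\<lambda>x. T x - u \<cdot> ip u x)" by (simp add: T_def u_def)
  have c: "star (ip u x) * ip u x \<preceq> ip x (T x)" for x
  proof -
    have "norm (ip (v n) (T (v n))) \<le> norm (ip (v n) (v n))"
      using T by (intro norm_mono) (auto simp: positive_contraction_def)
    also have "\<dots> \<le> 1" using v[of n] by (simp add: norm_ip_self power_le_one)
    finally show ?thesis
      using positive_contraction_Cauchy_Schwarz[OF T zero_less_one, of "v n" x]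
      by (simp add: u_def positive_contraction_sym[OF T])
  qed
  have "ip (T x - u \<cdot> ip u x) y = ip x (T y - u \<cdot> ip u y)" for x y
    by (simp add: ip_diff_left ip_diff_right ip_act_left ip_act_right star_ip positive_contraction_sym[OF T])
  moreover have "0 \<preceq> ip x (T x - u \<cdot> ip u x)" for x
    using c[of x] by (simp add: ip_diff_right ip_rank_one cstar_le_def)
  moreover have "ip x (T x - u \<cdot> ip u x) \<preceq> ip x x" for x
  proof -
    have "ip x (T x) + 0 \<preceq> ip x x + star (ip u x) * ip u x"
      using T by (intro cstar_le_add_mono zero_le_star_mult_self) (auto simp: positive_contraction_def)
    then show ?thesis by (simp add: ip_diff_right ip_rank_one cstar_le_def algebra_simps)
  qed
  ultimately show ?case unfolding S positive_contraction_def by blast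
qed

lemma residual_tendsto_0_if_infinitely_often:
  assumes v: "\<And>n. norm (v n) \<le> 1" and w: "infinite {n. v n = w}"
  shows "(\<lambda>n. residual v n w) \<longlonglongrightarrow> 0"
proof -
  define a where "a n = ip w (residual v n w)" for n
  have T: "positive_contraction (residual v n)" for n
    using v by (rule positive_contraction_residual)
  have step: "a n - a (Suc n) = star (ip (residual v n (v n)) w) * ip (residual v n (v n)) w" for n
    by (simp add: a_def ip_diff_right ip_rank_one)
  have sa: "star (a n) = a n" for n
    unfolding a_def by (rule positive_contraction_star[OF T])
  \<comment> \<open>Here \<open>ip (residual v n w) w\<close> equals \<open>a n\<close> by symmetry,
    so the drop is exactly the square.\<close>
  have "a n - a (Suc n) = a n * a n" if "v n = w" for n
    using step[of n] sa[of n] that by (simp add: a_def positive_contraction_sym[OF T])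
  then have "{n. v n = w} \<subseteq> {n. a n - a (Suc n) = a n * a n}" by blast
  then have "infinite {n. a n - a (Suc n) = a n * a n}" using w finite_subset by blast
  moreover have "0 \<preceq> a n" for n using T by (simp add: a_def positive_contraction_def)
  moreover have "a (Suc n) \<preceq> a n" for n
    using step[of n] zero_le_star_mult_self by (simp add: cstar_le_iff_diff[of "a (Suc n)"])
  ultimately have "a \<longlonglongrightarrow> 0" by (intro decreasing_by_square_tendsto_0 sa)
  from tendsto_real_sqrt[OF tendsto_norm_zero[OF this]]
  have "(\<lambda>n. sqrt (norm (a n))) \<longlonglongrightarrow> 0" by simp
  then show ?thesis
    by (rule Lim_null_comparison[rotated])
       (simp add: a_def real_le_rsqrt norm_positive_contraction_square_le[OF T])
qed

text \<open>Closedness rests on the bound \<open>norm_positive_contraction_le\<close>, uniform in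
  \<open>n\<close>; the algebraic closure properties rest on linearity and continuity of the
  operations.\<close>

lemma closed_submodule_residual_tendsto_0:
  assumes v: "\<And>n. norm (v n) \<le> 1"
  shows "closed_submodule {x. (\<lambda>n. residual v n x) \<longlonglongrightarrow> 0}"
proof -
  have T: "positive_contraction (residual v n)" for n
    using v by (rule positive_contraction_residual)
  note lin = positive_contraction_linear[OF T]
  have act: "(\<lambda>n. f n \<cdot> a) \<longlonglongrightarrow> 0" if "f \<longlonglongrightarrow> 0" for f a
  proof -
    have le: "norm (f n \<cdot> a) \<le> norm (f n) * norm a" for n
    proof (rule power2_le_imp_le)
      have "(norm (f n \<cdot> a))\<^sup>2 = norm (star a * (ip (f n) (f n) * a))"
        by (simp add: norm_ip_self[symmetric] ip_act_left ip_act_right mult.assoc)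
      also have "\<dots> \<le> norm (star a) * (norm (ip (f n) (f n)) * norm a)"
        by (meson mult_left_mono norm_ge_zero norm_mult_ineq order_trans)
      finally show "(norm (f n \<cdot> a))\<^sup>2 \<le> (norm (f n) * norm a)\<^sup>2"
        by (simp add: norm_ip_self power2_eq_square mult_ac)
    qed simp
    have "(\<lambda>n. norm (f n) * norm a) \<longlonglongrightarrow> 0"
      using tendsto_mult_left_zero[OF tendsto_norm_zero[OF that]] .
    then show ?thesis by (rule Lim_null_comparison[rotated]) (simp add: le)
  qed
  have scale: "(\<lambda>n. c *\<^sub>C f n) \<longlonglongrightarrow> 0" if "f \<longlonglongrightarrow> (0::'x)" for f c
  proof (rule tendsto_norm_zero_cancel)
    show "(\<lambda>n. norm (c *\<^sub>C f n)) \<longlonglongrightarrow> 0"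
      using tendsto_mult_right_zero[OF tendsto_norm_zero[OF that]] by (simp add: norm_scaleC)
  qed
  have "closed {x. (\<lambda>n. residual v n x) \<longlonglongrightarrow> 0}"
    unfolding closed_sequential_limits
  proof clarify
    fix X l assume X: "\<forall>k. X k \<in> {x. (\<lambda>n. residual v n x) \<longlonglongrightarrow> 0}" and l: "X \<longlonglongrightarrow> l"
    show "(\<lambda>n. residual v n l) \<longlonglongrightarrow> 0"
    proof (rule LIMSEQ_I)
      fix e :: real assume "e > 0"
      then obtain k where k: "norm (X k - l) < e / 2"
        using LIMSEQ_D[OF l, of "e / 2"] by auto
      obtain N where N: "\<And>n. n \<ge> N \<Longrightarrow> norm (residual v n (X k)) < e / 2"
        using LIMSEQ_D[of "\<lambda>n. residual v n (X k)" 0 "e / 2"] X \<open>e > 0\<close> by auto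
      have "norm (residual v n l - 0) < e" if "n \<ge> N" for n
      proof -
        have "residual v n l = residual v n (X k) - residual v n (X k - l)"
          by (simp add: lin)
        then have "norm (residual v n l) \<le> norm (residual v n (X k)) + norm (residual v n (X k - l))"
          by (metis norm_triangle_ineq4)
        also have "norm (residual v n (X k - l)) \<le> norm (X k - l)"
          by (rule norm_positive_contraction_le[OF T])
        finally show ?thesis using N[OF that] k by simp
      qed
      then show "\<exists>N. \<forall>n\<ge>N. norm (residual v n l - 0) < e" by blast
    qed
  qed
  then show ?thesis
    unfolding closed_submodule_def
    by (auto simp: lin intro: act scale tendsto_add_zero)
qed

text \<open>Basis vectors are counted from \<open>1\<close>, pursuit steps from \<open>0\<close>;
  hence the shift by one.\<close>

lemma residual_eq_sum:
  "residual v n x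
    = x - (\<Sum>i\<in>{1..n}. residual v (i - 1) (v (i - 1)) \<cdot> ip (residual v (i - 1) (v (i - 1))) x)"
  by (induction n) simp_all

text \<open>For finite \<open>G\<close> containing \<open>{1..n}\<close>, the remainder after
  \<open>G\<close> is a positive contraction whose form at \<open>x\<close> is at most that of
  \<open>residual v n\<close>, so its norm at \<open>x\<close> is controlled independently of
  \<open>G\<close>.\<close>

lemma unconditionally_convergent_if_residual_tendsto_0:
  assumes v: "\<And>n. norm (v n) \<le> 1" and lim: "\<And>x. (\<lambda>n. residual v n x) \<longlonglongrightarrow> 0"
  shows "unconditionally_convergent_right_basis {1..} (\<lambda>i. residual v (i - 1) (v (i - 1)))"
  unfolding unconditionally_convergent_right_basis_def
proof (intro allI impI)
  fix x and e :: real assume e: "e > 0"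
  define u where "u i = residual v (i - 1) (v (i - 1))" for i
  define R where "R F x = x - (\<Sum>i\<in>F. u i \<cdot> ip (u i) x)" for F x
  have T: "positive_contraction (R {1..n})" for n
  proof -
    have "R {1..n} = residual v n" unfolding R_def u_def residual_eq_sum[symmetric] by simp
    then show ?thesis using positive_contraction_residual[of v n] v by simp
  qed
  have ipR: "ip y (R F y) = ip y y - (\<Sum>i\<in>F. star (ip (u i) y) * ip (u i) y)" for y F
    by (simp add: R_def ip_diff_right ip_sum_right ip_rank_one)
  have sum_pos: "0 \<preceq> (\<Sum>i\<in>F. star (ip (u i) y) * ip (u i) y)" for y F
    by (intro cstar_sum_nonneg zero_le_star_mult_self)
  have anti: "ip y (R G y) \<preceq> ip y (R F y)" if "F \<subseteq> G" "finite G" for y F G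
    using sum_pos[of y "G - F"]
      sum.subset_diff[OF that, of "\<lambda>i. star (ip (u i) y) * ip (u i) y"]
    by (simp add: ipR cstar_le_def)
  \<comment> \<open>Positivity comes from an initial segment containing \<open>G\<close>:
    subtracting fewer terms leaves a larger form.\<close>
  have RG: "positive_contraction (R G)" if G: "finite G" "G \<subseteq> {1..}" for G
  proof -
    obtain n where "G \<subseteq> {..n}" using G(1) finite_nat_iff_bounded_le by auto
    with G(2) have n: "G \<subseteq> {1..n}" by auto
    have "ip (R G y) z = ip y (R G z)" for y z
      by (simp add: R_def ip_diff_left ip_diff_right ip_sum_left ip_sum_right ip_act_left ip_act_right star_ip)
    moreover have "0 \<preceq> ip y (R G y)" for y
      using anti[OF n, of y] T[of n] by (auto simp: positive_contraction_def intro: cstar_le_trans)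
    moreover have "ip y (R G y) \<preceq> ip y y" for y
      using sum_pos[of y G] by (simp add: ipR cstar_le_def)
    ultimately show ?thesis by (simp add: positive_contraction_def)
  qed
  have Rn: "R {1..n} x = residual v n x" for n
    unfolding R_def u_def residual_eq_sum[symmetric] ..
  \<comment> \<open>Chosen so that \<open>norm x * d < e\<^sup>2\<close>; the summand
    \<open>1\<close> covers \<open>x = 0\<close>.\<close>
  define d where "d = e\<^sup>2 / (norm x + 1)"
  have d: "d > 0" using e by (simp add: d_def add_nonneg_pos)
  obtain n where n: "norm (residual v n x) < d"
    using LIMSEQ_D[OF lim[of x] d] by auto
  have "norm (R G x) < e" if G: "finite G" "{1..n} \<subseteq> G" "G \<subseteq> {1..}" for G
  proof -
    have "(norm (R G x))\<^sup>2 \<le> norm (ip x (R G x))"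
      by (rule norm_positive_contraction_square_le[OF RG[OF G(1,3)]])
    also have "\<dots> \<le> norm (ip x (residual v n x))"
      using RG[OF G(1,3)] anti[OF G(2,1), of x]
      by (intro norm_mono) (auto simp: positive_contraction_def simp flip: Rn)
    also have "\<dots> \<le> norm x * norm (residual v n x)" by (rule norm_ip_le)
    also have "\<dots> \<le> norm x * d" using n by (intro mult_left_mono) auto
    also have "\<dots> < e\<^sup>2"
    proof -
      have "norm x * e\<^sup>2 < e\<^sup>2 * (norm x + 1)" using e by (simp add: algebra_simps)
      then show ?thesis by (simp add: d_def divide_less_eq add_nonneg_pos)
    qed
    finally show ?thesis using e by (simp add: power_less_imp_less_base)
  qed
  then show "\<exists>F. finite F \<and> F \<subseteq> {1..} \<and> (\<forall>G. finite G \<and> F \<subseteq> G \<and> G \<subseteq> {1..} \<longrightarrow>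
      norm (x - (\<Sum>i\<in>G. residual v (i - 1) (v (i - 1)) \<cdot> ip (residual v (i - 1) (v (i - 1))) x)) < e)"
    by (intro exI[of _ "{1..n}"]) (auto simp: R_def u_def)
qed

end

theorem proposition1p6:
  fixes act :: "'x::complex_banach \<Rightarrow> 'a::cstar_algebra \<Rightarrow> 'x"
    and ip :: "'x \<Rightarrow> 'x \<Rightarrow> 'a"
  assumes "right_hilbert_module act ip"
    and "right_hilbert_module.countably_generated act"
    and "sigma_unital TYPE('a)"
  shows "\<exists>u :: nat \<Rightarrow> 'x.
    right_hilbert_module.unconditionally_convergent_right_basis act ip {1..} u"
proof -
  interpret right_hilbert_module act ip by (rule assms(1))
  obtain S where S: "countable S" "closed_submodule hull S = UNIV"
    using assms(2) by (auto simp: countably_generated_def)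
  \<comment> \<open>Inserting \<open>0\<close> keeps the enumerated set nonempty when
    \<open>S\<close> is empty.\<close>
  define g where "g = from_nat_into (insert 0 S)"
  have g: "S \<subseteq> range g" using S(1) subset_range_from_nat_into[of "insert 0 S"] by (auto simp: g_def)
  \<comment> \<open>Each generator recurs for all second coordinates of the pair coded by
    \<open>n\<close>. The scaling brings its norm below \<open>1\<close> and is undone later inside
    the submodule.\<close>
  define v where "v n = (1 / (1 + norm (g (fst (prod_decode n))))) *\<^sub>R g (fst (prod_decode n))" for n
  have pos: "0 < 1 + norm y" for y :: 'x
    using norm_ge_zero[of y] by linarith
  have v: "norm (v n) \<le> 1" for n
    using pos[of "g (fst (prod_decode n))"] by (simp add: v_def abs_of_pos)
  let ?M = "{x. (\<lambda>n. residual v n x) \<longlonglongrightarrow> 0}"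
  have M: "closed_submodule ?M" using v by (rule closed_submodule_residual_tendsto_0)
  have "s \<in> ?M" if "s \<in> S" for s
  proof -
    obtain i where i: "s = g i" using g \<open>s \<in> S\<close> by auto
    define w where "w = (1 / (1 + norm s)) *\<^sub>R s"
    have "range (\<lambda>k. prod_encode (i, k)) \<subseteq> {n. v n = w}"
      by (auto simp: v_def w_def i)
    moreover have "infinite (range (\<lambda>k. prod_encode (i, k)))"
      by (intro range_inj_infinite injI) simp
    ultimately have "infinite {n. v n = w}" using finite_subset by blast
    with v have "w \<in> ?M" by (simp add: residual_tendsto_0_if_infinitely_often)
    then have "complex_of_real (1 + norm s) *\<^sub>C w \<in> ?M"
      using M by (simp only: closed_submodule_def)
    moreover have "complex_of_real (1 + norm s) *\<^sub>C w = s"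
      unfolding scaleR_scaleC[symmetric] w_def using pos[of s] by simp
    ultimately show ?thesis by simp
  qed
  then have "closed_submodule hull S \<subseteq> ?M" using M by (intro hull_minimal) auto
  then have "(\<lambda>n. residual v n x) \<longlonglongrightarrow> 0" for x using S(2) by auto
  with v show ?thesis using unconditionally_convergent_if_residual_tendsto_0 by blast
qed

end
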